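(* Let $P(z),Q(z)\in\mathbb{C}[z]$, $\deg P=n\ge 1$, and $a,b\in\mathbb{C}$, $a\ne b$. Let $d_a,d_b$ be the multiplicities of $a,b$ with respect to $P$, and let $P_{a_1}^{-1},\dots,P_{a_{d_a}}^{-1}$ and $P_{b_1}^{-1},\dots,P_{b_{d_b}}^{-1}$ be the branches of $P^{-1}$ in $U$ attached to $a$ and to $b$ (see context). Suppose that, in $U$, $$\frac1{d_a}\sum_{s=1}^{d_a}Q(P_{a_s}^{-1}(z))=\frac1{d_b}\sum_{s=1}^{d_b}Q(P_{b_s}^{-1}(z))\quad\text{if }P(a)=P(b),$$ or $$\frac1{d_a}\sum_{s=1}^{d_a}Q(P_{a_s}^{-1}(z))=0,\qquad \frac1{d_b}\sum_{s=1}^{d_b}Q(P_{b_s}^{-1}(z))=0\quad\text{if }P(a)\neq P(b).$$ Let $u_k$ be the coefficients of the Puiseux expansion of $Q(P^{-1}(z))$ near infinity, $Q(P_j^{-1}(z))=\sum_{k\ge -\deg Q}u_k\varepsilon_n^{jk}z^{-k/n}$, $0\le j\le n-1$. Then $u_k=0$ for every integer $k$ such that $\gcd(k,n)=1$.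
   Context: $U\subset\mathbb{C}$ is a simply connected domain containing no critical values of $P$, which contains, except possibly for their end points $P(a),P(b)$, two simple arcs $\gamma_a,\gamma_b$ starting at a common point $c\in U$, $c\ne P(a),P(b)$, and ending at $P(a)$ and $P(b)$ respectively; if $P(a)\neq P(b)$ the arcs meet only at $c$, and if $P(a)=P(b)$ then $\gamma_a=\gamma_b$. The branches $P_{a_1}^{-1},\dots,P_{a_{d_a}}^{-1}$ are the single-valued branches of $P^{-1}$ in $U$ which map points (of $\gamma_a$) close to $P(a)$ to points close to $a$, i.e. tend to $a$ as $z\to P(a)$ along $\gamma_a$; there are exactly $d_a$ of them. Similarly for $b$ with $\gamma_b$. Puiseux expansions: near infinity, after fixing one branch $P_0^{-1}(z)=\sum_{k=-1}^\infty v_kz^{-k/n}$ (with a fixed local branch of $z^{1/n}$), all branches are $P_j^{-1}(z)=\sum_{k=-1}^{\infty}v_k\varepsilon_n^{jk}z^{-k/n}$, $0\le j\le n-1$, $\varepsilon_n=\exp(2\pi i/n)$; the $u_k$ are obtained by substituting these series in $Q$. The vanishing of a given $u_k$ does not depend on the choices. *)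

theory Defs
  imports "HOL-Complex_Analysis.Complex_Analysis" "HOL-Computational_Algebra.Polynomial"
begin

definition critical_values :: "complex poly \<Rightarrow> complex set" where
  "critical_values P = poly P ` {w. poly (pderiv P) w = 0}"

definition mult_at :: "complex poly \<Rightarrow> complex \<Rightarrow> nat" where
  "mult_at P a = order a (P - [:poly P a:])"

definition inverse_branch ::
    "complex poly \<Rightarrow> complex set \<Rightarrow> (complex \<Rightarrow> complex) \<Rightarrow> bool" where
  "inverse_branch P U g \<longleftrightarrow> g holomorphic_on U \<and> (\<forall>z\<in>U. poly P (g z) = z)"

text \<open>Branches are total HOL functions; restricting to \<open>extensional U\<close> makes two branches that
  agree on \<open>U\<close> the same element, so that sums over this set count every branch once.
  The arc \<open>\<gamma>\<close> ends at \<open>P(a)\<close>, and the filter leaves out that end point, which need not lie in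
  \<open>U\<close>.\<close>

definition branches_attached ::
    "complex poly \<Rightarrow> complex set \<Rightarrow> (real \<Rightarrow> complex) \<Rightarrow> complex \<Rightarrow> (complex \<Rightarrow> complex) set" where
  "branches_attached P U \<gamma> a =
     {g \<in> extensional U. inverse_branch P U g \<and>
        (g \<longlongrightarrow> a) (at (poly P a) within path_image \<gamma>)}"

definition root_unity :: "nat \<Rightarrow> complex" where
  "root_unity n = exp (2 * of_real pi * \<i> / of_nat n)"

text \<open>\<open>r\<close> is a branch of the \<open>n\<close>-th root on a domain \<open>V\<close> near infinity, i.e. inside some
  \<open>|z| > R\<close> free of critical values of \<open>P\<close>, and \<open>F 0, \<dots>, F (n - 1)\<close> are the branches of
  the inverse of \<open>P\<close> on \<open>V\<close>, expanded in powers of \<open>r z\<close> with coefficients \<open>v\<close>.\<close>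

definition inverse_puiseux ::
    "complex poly \<Rightarrow> complex set \<Rightarrow> (complex \<Rightarrow> complex) \<Rightarrow> (nat \<Rightarrow> complex \<Rightarrow> complex) \<Rightarrow>
     (int \<Rightarrow> complex) \<Rightarrow> bool" where
  "inverse_puiseux P V r F v \<longleftrightarrow>
     open V \<and> connected V \<and> V \<noteq> {} \<and>
     (\<exists>R\<ge>0. critical_values P \<subseteq> cball 0 R \<and> V \<inter> cball 0 R = {}) \<and>
     r holomorphic_on V \<and> (\<forall>z\<in>V. r z ^ degree P = z) \<and>
     (\<forall>j<degree P. inverse_branch P V (F j) \<and>
        (\<forall>z\<in>V. ((\<lambda>k. v k * root_unity (degree P) powi (int j * k) * r z powi (- k))
                   has_sum F j z) {-1..}))"

text \<open>\<open>u\<close> is the coefficient sequence of the Puiseux expansion at infinity of \<open>Q\<close> composed with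
  the inverse of \<open>P\<close>, for some admissible choice of the domain, the root and the initial branch.
  Coefficients outside the range of summation are zero by convention.\<close>

definition puiseux_coeffs_at_infinity ::
    "complex poly \<Rightarrow> complex poly \<Rightarrow> (int \<Rightarrow> complex) \<Rightarrow> bool" where
  "puiseux_coeffs_at_infinity P Q u \<longleftrightarrow>
     (\<forall>k < - int (degree Q). u k = 0) \<and>
     (\<exists>V r F v. inverse_puiseux P V r F v \<and>
        (\<forall>j<degree P. \<forall>z\<in>V.
           ((\<lambda>k. u k * root_unity (degree P) powi (int j * k) * r z powi (- k))
              has_sum poly Q (F j z)) {- int (degree Q)..}))"

end

theory Submission
  imports Defs "HOL-Computational_Algebra.Fundamental_Theorem_Algebra" "HOL-Number_Theory.Cong"
begin

text \<open>
  Near \<open>P a\<close> the sum over the branches attached to \<open>a\<close> is the sum over all preimages close to \<open>a\<close>,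
  hence single valued, so the assumed relation can be continued along any path starting at \<open>P a\<close>.
  We continue it along rays from \<open>P a\<close> and \<open>P b\<close> to infinity in a common generic direction. Far out,
  every branch over such a ray is given by the Puiseux series and a root of unity \<open>\<omega>\<close>, and comparing
  coefficients yields \<open>u k * (\<Sum> c \<omega> * \<omega> powi (- k)) = 0\<close> with weights \<open>c \<omega>\<close> that are proportional to
  \<open>1 / d\<^sub>a\<close> and \<open>- 1 / d\<^sub>b\<close> if \<open>P a = P b\<close>, and separate relations for \<open>a\<close> and \<open>b\<close> otherwise.

  Suppose that \<open>k\<close> is coprime to \<open>n\<close> and \<open>u k \<noteq> 0\<close>. Galois conjugation replaces \<open>\<omega> powi (- k)\<close> by \<open>\<omega>\<close>,
  so the points on the unit circle that belong to \<open>a\<close> and those that belong to \<open>b\<close> have the same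
  centre of mass; therefore the two sets interlace. But they are the end points, on the Jordan curve
  \<open>\<bar>P\<bar> = R\<close>, of the preimages of the two rays emanating from \<open>a\<close> and from \<open>b\<close>. These are two disjoint
  stars inside the curve, and chords of a Jordan curve with interlaced end points meet.
\<close>

section \<open>Branches of the inverse of a polynomial\<close>

text \<open>The domain \<open>U\<close> may be bounded, and nothing is known about how its branches
  continue to infinity. Straight rays are chosen because a segment that starts inside the circle
  \<open>|z| = R\<close> and ends on it stays inside until its end, so its preimages stay inside the
  curve \<open>|P| = R\<close>. The direction is generic so that the rays avoid the critical values
  and, if they start at different points, are parallel and disjoint. Parallel rays with different
  origins meet the circle at different arguments, so the end points of the two stars are their roots
  of unity rotated by two different unit factors. If \<open>P a = P b\<close>, the rays and the
  factors coincide; otherwise both means are zero, and no rotation changes that. The star at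
  \<open>a\<close> has exactly \<open>d_a\<close> legs, which is why the weight
  \<open>1 / d_a\<close> produces a mean. Coprimality of \<open>k\<close> and \<open>n\<close> makes
  \<open>\<omega> powi (- k)\<close> a Galois conjugate of \<open>\<omega>\<close>, simultaneously
  for all roots of unity in the relation; for this the weights have to be rational.\<close>

lemma holomorphic_on_poly_fun: "poly P holomorphic_on S"
  unfolding holomorphic_on_def field_differentiable_def
  by (rule ballI, rule exI, rule has_field_derivative_at_within, rule poly_DERIV)

text \<open>Stated as an eventual property of the radius, so that it can be combined with further
  smallness conditions before one radius is picked.\<close>

lemma finite_separated:
  fixes S :: "'a::metric_space set"
  assumes "finite S"
  shows "\<forall>\<^sub>F e in at_right 0. \<forall>x\<in>S. \<forall>y\<in>S. x \<noteq> y \<longrightarrow> ball x e \<inter> ball y e = {}"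
proof -
  have "\<forall>\<^sub>F e in at_right 0. x \<noteq> y \<longrightarrow> ball x e \<inter> ball y e = {}" for x y :: 'a
  proof (cases "x = y")
    case False
    have "ball x e \<inter> ball y e = {}" if "e < dist x y / 2" for e
    proof -
      have "dist x y < e + e" if "z \<in> ball x e" "z \<in> ball y e" for z
        using that dist_triangle2[of x y z] by (simp add: dist_commute)
      with that show ?thesis by fastforce
    qed
    then show ?thesis
      using False by (intro eventually_at_rightI[of 0 "dist x y / 2"]) auto
  qed simp
  then show ?thesis
    using assms by (simp add: eventually_ball_finite)
qed

lemma poly_minus_const_neq_0:
  fixes P :: "complex poly"
  assumes "degree P > 0"
  shows "P - [:z:] \<noteq> 0" "degree (P - [:z:]) = degree P" "lead_coeff (P - [:z:]) = lead_coeff P"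
proof -
  have *: "P - [:z:] = P + [:-z:]" by simp
  show "degree (P - [:z:]) = degree P"
    unfolding * using assms by (intro degree_add_eq_left) auto
  then show "P - [:z:] \<noteq> 0" "lead_coeff (P - [:z:]) = lead_coeff P"
    using assms by (auto simp: coeff_eq_0 coeff_pCons split: nat.split)
qed

lemma finite_poly_fibre:
  fixes P :: "complex poly"
  assumes "degree P > 0"
  shows "finite {w. poly P w = z}"
  using poly_roots_finite[OF poly_minus_const_neq_0(1)[OF assms, of z]] by simp

text \<open>At a noncritical value \<open>P - z\<close> has no multiple root, so its linear factors
  are distinct.\<close>

lemma card_poly_fibre:
  fixes P :: "complex poly"
  assumes "degree P > 0" "z \<notin> critical_values P"
  shows "card {w. poly P w = z} = degree P"
proof -
  let ?p = "P - [:z:]"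
  have ne: "?p \<noteq> 0" using poly_minus_const_neq_0[OF assms(1)] by simp
  have rs: "rsquarefree ?p"
    using assms ne unfolding rsquarefree_roots critical_values_def
    by (auto simp: pderiv_diff pderiv_pCons)
  have "degree P = degree ?p" using poly_minus_const_neq_0[OF assms(1)] by simp
  also have "\<dots> = degree (smult (lead_coeff ?p) (\<Prod>w|poly ?p w = 0. [:-w, 1:]))"
    by (simp only: complex_poly_decompose_rsquarefree[OF rs])
  also have "\<dots> = card {w. poly ?p w = 0}"
    using ne by (simp add: degree_prod_sum_eq del: coeff_diff)
  finally show ?thesis by simp
qed

lemma finite_critical_values:
  fixes P :: "complex poly"
  assumes "degree P > 0"
  shows "finite (critical_values P)"
proof -
  have "pderiv P \<noteq> 0" using assms by (simp add: pderiv_eq_0_iff)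
  then show ?thesis unfolding critical_values_def by (simp add: poly_roots_finite)
qed

text \<open>All noncritical fibres have the same size. This replaces a properness argument: once
  each of the \<open>n\<close> small discs about the fibre over \<open>z\<close> contributes a
  preimage of a nearby value, there are no others.\<close>

lemma poly_covering_space:
  fixes P :: "complex poly"
  assumes deg: "degree P > 0" and U: "open U" "U \<inter> critical_values P = {}"
  shows "covering_space (poly P -` U) (poly P) U"
  unfolding covering_space_def
proof (intro conjI ballI)
  show cont: "continuous_on (poly P -` U) (poly P)" by (intro continuous_intros)
  show "poly P ` (poly P -` U) = U"
  proof -
    have "\<exists>w. z = poly P w" for z
      using alg_closed_imp_poly_has_root[of "P - [:z:]"] poly_minus_const_neq_0[OF deg, of z] deg by auto
    then have "surj (poly P)" unfolding surj_def by metis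
    then show ?thesis by (rule surj_image_vimage_eq)
  qed
  fix z assume z: "z \<in> U"
  define R where "R = {w. poly P w = z}"
  have finR: "finite R" and cardR: "card R = degree P"
    unfolding R_def using finite_poly_fibre[OF deg] card_poly_fibre[OF deg] U z by auto
  have inj: "\<forall>\<^sub>F e in at_right 0. inj_on (poly P) (ball w e)" if "w \<in> R" for w
  proof -
    have "poly (pderiv P) w \<noteq> 0"
      using that z U unfolding R_def critical_values_def by auto
    then have "deriv (poly P) w \<noteq> 0"
      using DERIV_imp_deriv[OF poly_DERIV[of P w]] by simp
    then obtain r where r: "r > 0" "inj_on (poly P) (ball w r)"
      using has_complex_derivative_locally_injective[of "poly P" UNIV w]
      by (auto intro: holomorphic_on_poly_fun)
    show ?thesis
      by (rule eventually_at_rightI[of 0 r]) (use r in \<open>auto intro!: inj_on_subset[OF r(2)]\<close>)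
  qed
  have "\<forall>\<^sub>F e in at_right (0::real). (\<forall>x\<in>R. \<forall>y\<in>R. x \<noteq> y \<longrightarrow> ball x e \<inter> ball y e = {}) \<and>
         (\<forall>w\<in>R. inj_on (poly P) (ball w e)) \<and> e > 0"
    by (intro eventually_conj finite_separated finR eventually_ball_finite ballI inj eventually_at_right_less)
  from eventually_happens'[OF trivial_limit_at_right_real this] obtain e where e: "e > 0" "\<And>w. w \<in> R \<Longrightarrow> inj_on (poly P) (ball w e)"
      "\<And>x y. x \<in> R \<Longrightarrow> y \<in> R \<Longrightarrow> x \<noteq> y \<Longrightarrow> ball x e \<inter> ball y e = {}"
    by blast
  have op: "open (poly P ` ball w e)" if "w \<in> R" for w
    using open_mapping_thm3[of "poly P" "ball w e"] e(2)[OF that] by (auto intro: holomorphic_on_poly_fun)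
  define T where "T = U \<inter> (\<Inter>w\<in>R. poly P ` ball w e)"
  have opT: "open T" unfolding T_def using U finR op by (intro open_Int open_INT) auto
  have zT: "z \<in> T" using z e(1) by (auto simp: T_def R_def)
  define u where "u w = ball w e \<inter> poly P -` T" for w
  have opu: "open (u w)" for w
    unfolding u_def using opT by (intro open_Int open_vimage) (auto intro: continuous_intros)
  have imu: "poly P ` u w = T" if "w \<in> R" for w
  proof -
    have "T \<subseteq> poly P ` ball w e" using that by (auto simp: T_def)
    then show ?thesis unfolding u_def by blast
  qed
  \<comment> \<open>The map \<open>f\<close> picks one preimage of \<open>y\<close> in each of the
    disjoint discs. These are already \<open>degree P\<close> many, so \<open>x\<close> is among
    them.\<close>
  have cover: "x \<in> \<Union>(u ` R)" if "poly P x \<in> T" for x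
  proof -
    define y where "y = poly P x"
    have yT: "y \<in> T" and yx: "poly P x = y" using that y_def by auto
    have "\<forall>w\<in>R. \<exists>v. v \<in> ball w e \<and> poly P v = y"
    proof
      fix w assume "w \<in> R"
      then have "y \<in> poly P ` ball w e" using yT unfolding T_def by blast
      then show "\<exists>v. v \<in> ball w e \<and> poly P v = y" by blast
    qed
    then obtain f where f: "\<And>w. w \<in> R \<Longrightarrow> f w \<in> ball w e \<and> poly P (f w) = y" by metis
    have "inj_on f R"
    proof (rule inj_onI)
      fix v w assume "v \<in> R" "w \<in> R" "f v = f w"
      then have "f w \<in> ball v e \<inter> ball w e" using f[of v] f[of w] by simp
      then show "v = w" using e(3)[of v w] \<open>v \<in> R\<close> \<open>w \<in> R\<close> by blast
    qed
    then have "card (f ` R) = degree P" by (simp add: card_image cardR)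
    moreover have "f ` R \<subseteq> {w. poly P w = y}" using f by auto
    moreover have "card {w. poly P w = y} = degree P"
      using card_poly_fibre[OF deg] yT U unfolding T_def by auto
    ultimately have "f ` R = {w. poly P w = y}"
      using card_subset_eq[OF finite_poly_fibre[OF deg]] by metis
    then obtain w where "w \<in> R" "x = f w" using yx by blast
    then show ?thesis using f[of w] that by (auto simp: u_def)
  qed
  show "\<exists>T. z \<in> T \<and> openin (top_of_set U) T \<and>
         (\<exists>v. \<Union> v = poly P -` U \<inter> poly P -` T \<and>
              (\<forall>u\<in>v. openin (top_of_set (poly P -` U)) u) \<and>
              pairwise disjnt v \<and> (\<forall>u\<in>v. \<exists>q. homeomorphism u T (poly P) q))"
  proof (intro exI[of _ T] conjI exI[of _ "u ` R"])
    show "z \<in> T" by (fact zT)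
    show "openin (top_of_set U) T" 
      using opT U by (auto simp: openin_open_eq T_def)
    show "\<Union> (u ` R) = poly P -` U \<inter> poly P -` T"
      using cover unfolding u_def T_def by auto
    show "\<forall>u\<in>u ` R. openin (top_of_set (poly P -` U)) u"
    proof
      fix s assume "s \<in> u ` R"
      then obtain w where "s = u w" by auto
      moreover have "u w \<subseteq> poly P -` U" by (auto simp: u_def T_def)
      ultimately show "openin (top_of_set (poly P -` U)) s"
        using opu[of w] by (simp add: open_openin_trans open_subset)
    qed
    show "pairwise disjnt (u ` R)"
      using e(3) by (fastforce simp: pairwise_def disjnt_def u_def)
    show "\<forall>u\<in>u ` R. \<exists>q. homeomorphism u T (poly P) q"
    proof
      fix s assume "s \<in> u ` R"
      then obtain w where w: "w \<in> R" "s = u w" by auto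
      have "inj_on (poly P) (u w)" using inj_on_subset[OF e(2)[OF w(1)]] by (simp add: u_def)
      then obtain q where q: "q holomorphic_on poly P ` u w" "\<And>x. x \<in> u w \<Longrightarrow> q (poly P x) = x"
        using holomorphic_has_inverse[OF holomorphic_on_poly_fun opu[of w]] by metis
      have "homeomorphism (u w) T (poly P) q"
        unfolding imu[OF w(1), symmetric] using q
        by (intro homeomorphismI holomorphic_on_imp_continuous_on holomorphic_on_poly_fun) auto
      then show "\<exists>q. homeomorphism s T (poly P) q" using w by blast
    qed
  qed
qed

section \<open>Inverse branches as lifts of the identity through the covering\<close>

locale regular_domain =
  fixes P :: "complex poly" and W :: "complex set"
  assumes deg: "degree P > 0" and opW: "open W" and conW: "connected W"
    and regW: "W \<inter> critical_values P = {}"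
begin

lemma covering: "covering_space (poly P -` W) (poly P) W"
  using poly_covering_space deg opW regW by blast

lemma inverse_branch_unique:
  assumes "inverse_branch P W g" "inverse_branch P W h" "z \<in> W" "g z = h z" "x \<in> W"
  shows "g x = h x"
  using assms conW unfolding inverse_branch_def
  by (intro covering_space_lift_unique[OF covering, of g z h W "\<lambda>x. x" x])
     (auto intro: holomorphic_on_imp_continuous_on)

definition branches :: "(complex \<Rightarrow> complex) set" where
  "branches = {g \<in> extensional W. inverse_branch P W g}"

lemma inverse_branch_exists:
  assumes "simply_connected W" "z \<in> W" "poly P w = z"
  obtains g where "g \<in> branches" "g z = w"
proof -
  have lpc: "locally path_connected W" by (simp add: opW open_imp_locally_path_connected)
  obtain g where g: "continuous_on W g" "g \<in> W \<rightarrow> poly P -` W" "g z = w" "\<And>y. y \<in> W \<Longrightarrow> poly P (g y) = y"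
    using covering_space_lift_strong[OF covering _ assms(2,1) lpc continuous_on_id, of w] assms
    by (metis (no_types, lifting) Pi_I vimageI)
  have hol: "g holomorphic_on W"
    by (rule covering_space_lift_is_holomorphic[OF covering, of "\<lambda>x. x"])
       (use g opW in \<open>auto intro!: holomorphic_intros open_vimage continuous_intros\<close>)
  have "restrict g W \<in> branches"
    using g hol by (auto simp: branches_def inverse_branch_def cong: holomorphic_cong)
  moreover have "restrict g W z = w" using assms g by auto
  ultimately show ?thesis using that by blast
qed

end

locale sc_regular_domain = regular_domain +
  assumes scW: "simply_connected W"
begin

lemma poly_branch:
  assumes "g \<in> branches" "z \<in> W"
  shows "poly P (g z) = z"
  using assms unfolding branches_def inverse_branch_def by simp

text \<open>Lifts of the identity are determined by one value, and simple connectedness lets every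
  point of the fibre be such a value.\<close>

lemma bij_branches:
  assumes "z \<in> W"
  shows "bij_betw (\<lambda>g. g z) branches {w. poly P w = z}"
proof (rule bij_betwI')
  fix g h assume gh: "g \<in> branches" "h \<in> branches"
  show "g z = h z \<longleftrightarrow> g = h"
  proof
    assume eq: "g z = h z"
    have "g x = h x" if "x \<in> W" for x
      using inverse_branch_unique[of g h z x, OF _ _ assms eq that] gh by (simp add: branches_def)
    then show "g = h" using gh by (intro extensionalityI[of g W h]) (auto simp: branches_def)
  qed simp
next
  show "g z \<in> {w. poly P w = z}" if "g \<in> branches" for g
    using poly_branch[OF that assms] by simp
next
  show "\<exists>g\<in>branches. w = g z" if "w \<in> {w. poly P w = z}" for w
  proof -
    have "poly P w = z" using that by simp
    from inverse_branch_exists[OF scW assms this] show ?thesis by metis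
  qed
qed

lemma finite_branches: "finite branches"
proof -
  show ?thesis
  proof (cases "W = {}")
    case False
    then obtain z where "z \<in> W" by blast
    then show ?thesis using bij_betw_finite[OF bij_branches] finite_poly_fibre[OF deg] by blast
  next
    case True
    then have "branches \<subseteq> {\<lambda>_. undefined}" unfolding branches_def extensional_def by auto
    then show ?thesis using finite_subset by blast
  qed
qed

text \<open>The form in which \<open>z\<close> can tend to a boundary value of \<open>W\<close>:
  branches with a common limit then produce a multiple root.\<close>

lemma poly_eq_prod_branches:
  assumes "z \<in> W"
  shows "poly P x - z = lead_coeff P * (\<Prod>g\<in>branches. (x - g z))"
proof -
  let ?p = "P - [:z:]"
  have nc: "z \<notin> critical_values P" using assms regW by auto
  have rs: "rsquarefree ?p"
    using deg nc poly_minus_const_neq_0[OF deg, of z] unfolding rsquarefree_roots critical_values_def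
    by (auto simp: pderiv_diff pderiv_pCons)
  have "poly P x - z = poly ?p x" by simp
  also have "\<dots> = poly (smult (lead_coeff ?p) (\<Prod>w|poly ?p w = 0. [:-w, 1:])) x"
    by (simp only: complex_poly_decompose_rsquarefree[OF rs])
  also have "\<dots> = lead_coeff P * (\<Prod>w|poly P w = z. (x - w))"
    by (subst poly_minus_const_neq_0(3)[OF deg]) (simp add: poly_prod)
  also have "(\<Prod>w|poly P w = z. (x - w)) = (\<Prod>g\<in>branches. (x - g z))"
    using prod.reindex_bij_betw[OF bij_branches[OF assms], of "\<lambda>w. x - w"] by simp
  finally show ?thesis .
qed

end

section \<open>Behaviour of the branches near a value\<close>

lemma order_prod_linear:
  fixes w :: "'i \<Rightarrow> complex"
  assumes "finite I"
  shows "order a (\<Prod>i\<in>I. [:- w i, 1:]) = card {i\<in>I. w i = a}"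
  using assms
proof (induction I)
  case empty
  then show ?case by (simp add: order_0I)
next
  case (insert i I)
  have eq: "{j \<in> insert i I. w j = a} = (if w i = a then insert i {j \<in> I. w j = a} else {j \<in> I. w j = a})"
    by auto
  have "[:- w i, 1:] * (\<Prod>i\<in>I. [:- w i, 1:]) \<noteq> 0"
    using insert by (intro no_zero_divisors) (auto simp: prod_zero_iff)
  then have "order a (\<Prod>i\<in>insert i I. [:- w i, 1:]) = order a [:- w i, 1:] + card {j\<in>I. w j = a}"
    unfolding prod.insert[OF insert.hyps] insert.IH[symmetric] by (rule order_mult)
  also have "order a [:- w i, 1:] = (if w i = a then 1 else 0)"
    using order_power_n_n[of a 1] by (auto simp: order_0I)
  finally show ?case using insert.hyps unfolding eq by auto
qed

lemma arc_tail:
  fixes \<gamma> :: "real \<Rightarrow> 'a::metric_space"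
  assumes "arc \<gamma>" "pathfinish \<gamma> = t" "path_image \<gamma> - {t} \<subseteq> W" "\<delta> > 0"
  obtains C where "connected C" "C \<noteq> {}" "C \<subseteq> W" "C \<subseteq> ball t \<delta> - {t}"
    "\<forall>\<^sub>F z in at t within path_image \<gamma>. z \<in> C"
proof -
  have cont: "continuous_on {0..1} \<gamma>" and inj: "inj_on \<gamma> {0..1}" and fin: "\<gamma> 1 = t"
    using assms by (auto simp: arc_def path_def pathfinish_def)
  obtain d where d: "d > 0" "\<And>x. x \<in> {0..1} \<Longrightarrow> dist x 1 < d \<Longrightarrow> dist (\<gamma> x) (\<gamma> 1) < \<delta>"
    using cont \<open>\<delta> > 0\<close> unfolding continuous_on_iff by (metis atLeastAtMost_iff order_refl zero_le_one)
  \<comment> \<open>The bound \<open>1 - d/2\<close> keeps the tail within parameter distance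
    \<open>d\<close> of the end, and \<open>1/2\<close> keeps \<open>\<sigma>\<close>
    positive.\<close>
  define \<sigma> where "\<sigma> = max (1/2) (1 - d/2)"
  have \<sigma>: "0 < \<sigma>" "\<sigma> < 1" using d(1) by (auto simp: \<sigma>_def)
  define C where "C = \<gamma> ` {\<sigma>..<1}"
  have nt: "\<gamma> x \<noteq> t" if "x \<in> {0..<1}" for x
    using inj_onD[OF inj, of x 1] that fin by auto
  show ?thesis
  proof (rule that[of C])
    show "connected C" unfolding C_def
      by (intro connected_continuous_image continuous_on_subset[OF cont]) (use \<sigma> in auto)
    show "C \<noteq> {}" using \<sigma> by (auto simp: C_def)
    show "C \<subseteq> W"
    proof
      fix z assume "z \<in> C"
      then obtain x where "x \<in> {\<sigma>..<1}" "z = \<gamma> x" by (auto simp: C_def)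
      then show "z \<in> W" using nt[of x] \<sigma> assms(3) by (auto simp: path_image_def)
    qed
    show "C \<subseteq> ball t \<delta> - {t}"
    proof
      fix z assume "z \<in> C"
      then obtain x where x: "x \<in> {\<sigma>..<1}" "z = \<gamma> x" by (auto simp: C_def)
      have "dist x 1 < d" using x \<sigma> d(1) by (auto simp: dist_real_def \<sigma>_def)
      then show "z \<in> ball t \<delta> - {t}" using nt[of x] d(2)[of x] x \<sigma> fin by (auto simp: dist_commute)
    qed
    \<comment> \<open>An arc does not return to its end point: the initial piece has positive
      distance from \<open>t\<close>, so close to \<open>t\<close> only the tail is met.\<close>
    have "compact (\<gamma> ` {0..\<sigma>})"
      by (intro compact_continuous_image continuous_on_subset[OF cont]) (use \<sigma> in auto)
    moreover have "t \<notin> \<gamma> ` {0..\<sigma>}" using nt \<sigma> by force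
    ultimately have "open (- (\<gamma> ` {0..\<sigma>}))" "t \<in> - (\<gamma> ` {0..\<sigma>})"
      by (auto simp: compact_imp_closed open_Compl)
    then have "\<forall>\<^sub>F z in at t within path_image \<gamma>. z \<in> - (\<gamma> ` {0..\<sigma>})"
      by (meson eventually_at_topological)
    moreover have "\<forall>\<^sub>F z in at t within path_image \<gamma>. z \<in> path_image \<gamma> \<and> z \<noteq> t"
      by (simp add: eventually_at_filter)
    ultimately show "\<forall>\<^sub>F z in at t within path_image \<gamma>. z \<in> C"
    proof eventually_elim
      case (elim z)
      then obtain x where x: "x \<in> {0..1}" "z = \<gamma> x" by (auto simp: path_image_def)
      moreover have "\<not> x \<le> \<sigma>" using elim x by auto
      moreover have "x \<noteq> 1" using elim x fin by auto
      ultimately show ?case unfolding C_def by auto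
    qed
  qed
qed

lemma arc_end_nontrivial:
  fixes \<gamma> :: "real \<Rightarrow> 'a::metric_space"
  assumes "arc \<gamma>" "pathfinish \<gamma> = t"
  shows "at t within path_image \<gamma> \<noteq> bot"
proof -
  have "connected (path_image \<gamma>)" using assms arc_imp_path connected_path_image by blast
  moreover have "t \<in> path_image \<gamma>" using assms pathfinish_in_path_image by blast
  moreover have "pathstart \<gamma> \<in> path_image \<gamma>" by (rule pathstart_in_path_image)
  moreover have "pathstart \<gamma> \<noteq> t" using assms arc_distinct_ends by blast
  ultimately have "path_image \<gamma> \<noteq> {x}" for x by (metis singletonD)
  then have "t islimpt path_image \<gamma>"
    by (rule connected_imp_perfect[OF \<open>connected (path_image \<gamma>)\<close> \<open>t \<in> path_image \<gamma>\<close>])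
  then show ?thesis using trivial_limit_within by blast
qed

text \<open>Over the disc of radius \<open>\<delta>\<close> all preimages lie in disjoint balls of
  radius \<open>\<epsilon>\<close> about the points of the fibre over \<open>t\<close>. The centre
  itself may be a critical value, and then a ball contains several preimages of one point.\<close>

locale fibre_disc =
  fixes P :: "complex poly" and t :: complex and \<epsilon> \<delta> :: real
  assumes deg: "degree P > 0" and eps: "\<epsilon> > 0" and del: "\<delta> > 0"
    and sep: "\<And>v w. poly P v = t \<Longrightarrow> poly P w = t \<Longrightarrow> v \<noteq> w \<Longrightarrow> ball v \<epsilon> \<inter> ball w \<epsilon> = {}"
    and near: "\<And>w. poly P w \<in> ball t \<delta> \<Longrightarrow> \<exists>v. poly P v = t \<and> w \<in> ball v \<epsilon>"
    and nocrit: "critical_values P \<inter> ball t \<delta> \<subseteq> {t}"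

lemma fibre_disc_exists:
  fixes P :: "complex poly"
  assumes deg: "degree P > 0" and e: "e > 0"
  obtains \<epsilon> \<delta> where "\<epsilon> \<le> e" "fibre_disc P t \<epsilon> \<delta>"
proof -
  have "\<forall>\<^sub>F \<epsilon> in at_right 0. \<epsilon> < e" using e by (auto simp: eventually_at_right_field)
  then have "\<forall>\<^sub>F \<epsilon> in at_right 0. \<epsilon> < e \<and> \<epsilon> > 0 \<and>
     (\<forall>v\<in>{w. poly P w = t}. \<forall>w\<in>{w. poly P w = t}. v \<noteq> w \<longrightarrow> ball v \<epsilon> \<inter> ball w \<epsilon> = {})"
    by (intro eventually_conj finite_separated finite_poly_fibre deg eventually_at_right_less)
  from eventually_happens'[OF trivial_limit_at_right_real this]
  obtain \<epsilon> where \<epsilon>: "\<epsilon> < e" "\<epsilon> > 0"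
     "\<And>v w. poly P v = t \<Longrightarrow> poly P w = t \<Longrightarrow> v \<noteq> w \<Longrightarrow> ball v \<epsilon> \<inter> ball w \<epsilon> = {}" by blast
  obtain d where d: "d > 0" "\<And>x. x \<in> critical_values P \<Longrightarrow> x \<noteq> t \<Longrightarrow> d \<le> dist t x"
    using finite_set_avoid[OF finite_critical_values[OF deg], of t] by metis
  let ?p = "P - [:t:]"
  have lc: "lead_coeff P \<noteq> 0" using deg by auto
  \<comment> \<open>If \<open>w\<close> has distance at least \<open>\<epsilon>\<close> from every
    root of \<open>P - t\<close>, the factorization gives
    \<open>|P w - t| \<ge> |lead_coeff P| * \<epsilon> ^ n\<close>. The number \<open>d\<close>
    keeps other critical values away.\<close>
  define \<delta> where "\<delta> = min d (cmod (lead_coeff P) * \<epsilon> ^ degree P)"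
  have "\<delta> > 0" using d \<epsilon> lc by (simp add: \<delta>_def)
  obtain root where "smult (lead_coeff ?p) (\<Prod>i<degree ?p. [:-root i, 1:]) = ?p"
    using complex_poly_decompose' by blast
  then have root: "smult (lead_coeff P) (\<Prod>i<degree P. [:-root i, 1:]) = ?p"
    using poly_minus_const_neq_0[OF deg] by metis
  have ev: "poly P w - t = lead_coeff P * (\<Prod>i<degree P. (w - root i))" for w
    using arg_cong[OF root, of "\<lambda>p. poly p w"] by (simp add: poly_prod)
  have near: "\<exists>v. poly P v = t \<and> w \<in> ball v \<epsilon>" if "poly P w \<in> ball t \<delta>" for w
  proof (rule ccontr)
    assume "\<not> ?thesis"
    moreover have "poly P (root i) = t" if "i < degree P" for i
    proof -
      have "(\<Prod>j<degree P. (root i - root j)) = 0" using that by (auto simp: prod_zero_iff)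
      then show ?thesis using ev[of "root i"] by (simp only: mult_zero_right) simp
    qed
    ultimately have far: "\<epsilon> \<le> cmod (w - root i)" if "i < degree P" for i
      using that by (force simp: dist_norm norm_minus_commute)
    have "\<epsilon> ^ degree P = (\<Prod>i<degree P. \<epsilon>)" by simp
    also have "\<dots> \<le> (\<Prod>i<degree P. cmod (w - root i))"
      using \<epsilon> far by (intro prod_mono) auto
    finally have "cmod (lead_coeff P) * \<epsilon> ^ degree P \<le> cmod (poly P w - t)"
      unfolding ev norm_mult prod_norm[symmetric] by (intro mult_left_mono) auto
    then show False using that by (auto simp: \<delta>_def dist_norm norm_minus_commute)
  qed
  have "critical_values P \<inter> ball t \<delta> \<subseteq> {t}"
    using d(2) by (force simp: \<delta>_def)
  then have "fibre_disc P t \<epsilon> \<delta>" using deg \<epsilon> near \<open>\<delta> > 0\<close> by unfold_locales auto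
  then show ?thesis using that[of \<epsilon> \<delta>] \<epsilon> by auto
qed

section \<open>Sums over the preimages close to one point of a fibre\<close>

context fibre_disc
begin

lemma connected_in_ball:
  assumes "connected C" "C \<noteq> {}" "poly P ` C \<subseteq> ball t \<delta>"
  obtains v where "poly P v = t" "C \<subseteq> ball v \<epsilon>"
proof -
  obtain x where x: "x \<in> C" using assms by blast
  then obtain v where v: "poly P v = t" "x \<in> ball v \<epsilon>" using near[of x] assms by blast
  define B where "B = (\<Union>w\<in>{w. poly P w = t} - {v}. ball w \<epsilon>)"
  have "C \<subseteq> ball v \<epsilon> \<union> B" using near assms(3) by (force simp: B_def)
  moreover have "ball v \<epsilon> \<inter> B \<inter> C = {}" using sep[OF v(1)] by (auto simp: B_def)
  moreover have "ball v \<epsilon> \<inter> C \<noteq> {}" using x v by auto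
  moreover have "open B" by (auto simp: B_def)
  ultimately have "B \<inter> C = {}" using connectedD[OF assms(1), of "ball v \<epsilon>" B] by auto
  then have "C \<subseteq> ball v \<epsilon>" using \<open>C \<subseteq> ball v \<epsilon> \<union> B\<close> by blast
  then show ?thesis using that v by blast
qed

lemma branch_ball:
  assumes "inverse_branch P W g" "connected C" "C \<noteq> {}" "C \<subseteq> W" "C \<subseteq> ball t \<delta>"
  obtains v where "poly P v = t" "g ` C \<subseteq> ball v \<epsilon>"
proof -
  have g: "continuous_on W g" "\<And>z. z \<in> W \<Longrightarrow> poly P (g z) = z"
    using assms(1) by (auto simp: inverse_branch_def intro: holomorphic_on_imp_continuous_on)
  have "connected (g ` C)" using assms continuous_on_subset[OF g(1)] connected_continuous_image by blast
  moreover have "poly P ` g ` C \<subseteq> ball t \<delta>"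
  proof -
    have "poly P (g x) = x" if "x \<in> C" for x using g(2) assms(4) that by blast
    then show ?thesis using assms(5) by (auto simp del: mem_ball)
  qed
  ultimately show ?thesis using connected_in_ball[of "g ` C"] assms that by blast
qed

lemma branch_ball_iff:
  assumes "inverse_branch P W g" "connected C" "C \<subseteq> W" "C \<subseteq> ball t \<delta>" "y \<in> C" "z \<in> C" "poly P a = t"
  shows "g y \<in> ball a \<epsilon> \<longleftrightarrow> g z \<in> ball a \<epsilon>"
proof -
  obtain v where v: "poly P v = t" "g ` C \<subseteq> ball v \<epsilon>" using branch_ball[OF assms(1,2) _ assms(3,4)] assms by blast
  then have "g y \<in> ball v \<epsilon>" "g z \<in> ball v \<epsilon>" using assms by auto
  then show ?thesis using sep[OF v(1) assms(7)] by blast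
qed

text \<open>The sum over all preimages close to \<open>a\<close> is single valued on the punctured disc about \<open>t\<close>,
  whereas the branches themselves are permuted by the monodromy. This is what carries a relation
  between branches on one domain over to another one ending at the same value.\<close>

definition locsum :: "complex poly \<Rightarrow> complex \<Rightarrow> complex \<Rightarrow> complex" where
  "locsum Q a z = (\<Sum>w\<in>{w. poly P w = z \<and> w \<in> ball a \<epsilon>}. poly Q w)"

text \<open>The branches on the right are selected at the fixed point \<open>y\<close>, so the right
  side is holomorphic in \<open>z\<close>. The selection is the same at \<open>z\<close> because a
  branch cannot pass from one ball to another over the connected set \<open>D\<close>.\<close>

lemma locsum_eq:
  assumes W: "sc_regular_domain P W" and D: "connected D" "D \<subseteq> W" "D \<subseteq> ball t \<delta>" "y \<in> D" "z \<in> D"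
    and a: "poly P a = t"
  shows "locsum Q a z = (\<Sum>g\<in>{g \<in> regular_domain.branches P W. g y \<in> ball a \<epsilon>}. poly Q (g z))"
proof -
  interpret sc_regular_domain P W by (fact W)
  have zW: "z \<in> W" using D by auto
  have "{g \<in> branches. g y \<in> ball a \<epsilon>} = {g \<in> branches. g z \<in> ball a \<epsilon>}"
    using branch_ball_iff[OF _ D(1,2,3,4,5) a] by (auto simp: branches_def)
  moreover have "bij_betw (\<lambda>g. g z) {g \<in> branches. g z \<in> ball a \<epsilon>} {w. poly P w = z \<and> w \<in> ball a \<epsilon>}"
  proof (rule bij_betwI')
    show "g z = h z \<longleftrightarrow> g = h" if "g \<in> {g \<in> branches. g z \<in> ball a \<epsilon>}" "h \<in> {g \<in> branches. g z \<in> ball a \<epsilon>}" for g h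
      using bij_betw_imp_inj_on[OF bij_branches[OF zW]] that unfolding inj_on_def by blast
    show "g z \<in> {w. poly P w = z \<and> w \<in> ball a \<epsilon>}" if "g \<in> {g \<in> branches. g z \<in> ball a \<epsilon>}" for g
      using that poly_branch[of g z] zW by simp
    show "\<exists>g\<in>{g \<in> branches. g z \<in> ball a \<epsilon>}. w = g z" if "w \<in> {w. poly P w = z \<and> w \<in> ball a \<epsilon>}" for w
    proof -
      have "w \<in> (\<lambda>g. g z) ` branches" using bij_betw_imp_surj_on[OF bij_branches[OF zW]] that by auto
      then show ?thesis using that by auto
    qed
  qed
  ultimately show ?thesis
    unfolding locsum_def by (simp only: sum.reindex_bij_betw[of "\<lambda>g. g z", symmetric])
qed

text \<open>A small disc that misses \<open>t\<close> is free of critical values and carries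
  single-valued branches, even though these need not extend to the whole punctured disc.\<close>

lemma locsum_holomorphic:
  assumes a: "poly P a = t"
  shows "locsum Q a holomorphic_on ball t \<delta> - {t}"
proof (rule analytic_imp_holomorphic, unfold analytic_on_def, intro ballI)
  fix z0 assume z0: "z0 \<in> ball t \<delta> - {t}"
  then obtain r where r: "r > 0" "ball z0 r \<subseteq> ball t \<delta> - {t}"
    by (meson open_ball open_contains_ball open_delete)
  have W: "sc_regular_domain P (ball z0 r)"
    by unfold_locales (use deg nocrit r in \<open>auto intro: convex_imp_simply_connected\<close>)
  interpret W: sc_regular_domain P "ball z0 r" by (fact W)
  have "(\<lambda>z. \<Sum>g\<in>{g \<in> W.branches. g z0 \<in> ball a \<epsilon>}. poly Q (g z)) holomorphic_on ball z0 r"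
    by (intro holomorphic_intros holomorphic_on_compose[OF _ holomorphic_on_poly_fun, unfolded o_def])
       (auto simp: W.branches_def inverse_branch_def)
  then have "locsum Q a holomorphic_on ball z0 r"
  proof (rule holomorphic_transform)
    fix z assume "z \<in> ball z0 r"
    then show "(\<Sum>g\<in>{g \<in> W.branches. g z0 \<in> ball a \<epsilon>}. poly Q (g z)) = locsum Q a z"
      using locsum_eq[OF W, of "ball z0 r" z0 z a Q] r a by (simp add: subset_Diff_insert)
  qed
  then show "\<exists>e>0. locsum Q a holomorphic_on ball z0 e" using r by blast
qed

end

text \<open>Common frame for the given domain \<open>U\<close> with its arcs and for a sector about
  a ray; the arc gives access to \<open>t\<close>, which need not belong to
  \<open>W\<close>.\<close>

locale ended_domain = sc_regular_domain +
  fixes \<gamma> :: "real \<Rightarrow> complex" and t :: complex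
  assumes arc: "arc \<gamma>" "pathfinish \<gamma> = t" "path_image \<gamma> - {t} \<subseteq> W"
begin

text \<open>Turns attachment, a limit condition, into a condition at a single point \<open>z\<close>
  of the tail.\<close>

lemma branch_tendsto_iff:
  assumes D: "fibre_disc P t \<epsilon> \<delta>" and C: "connected C" "C \<subseteq> W" "C \<subseteq> ball t \<delta>"
      "\<forall>\<^sub>F z in at t within path_image \<gamma>. z \<in> C"
    and g: "g \<in> branches" and a: "poly P a = t" and z: "z \<in> C"
  shows "(g \<longlongrightarrow> a) (at t within path_image \<gamma>) \<longleftrightarrow> g z \<in> ball a \<epsilon>"
proof -
  let ?F = "at t within path_image \<gamma>"
  interpret D: fibre_disc P t \<epsilon> \<delta> by (fact D)
  have br: "inverse_branch P W g" using g by (simp add: branches_def)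
  have nt: "?F \<noteq> bot" using arc_end_nontrivial arc by blast
  obtain v where v: "poly P v = t" "g ` C \<subseteq> ball v \<epsilon>" using D.branch_ball[OF br C(1) _ C(2,3)] z by blast
  have lim: "(g \<longlongrightarrow> v) ?F"
  proof (rule tendstoI)
    \<comment> \<open>A smaller disc of the same kind confines a later tail to a ball of radius at
      most \<open>e\<close>. The two tails overlap, so this ball has the same centre
      \<open>v\<close>.\<close>
    fix e :: real assume "e > 0"
    then obtain \<epsilon>' \<delta>' where D': "\<epsilon>' \<le> min e \<epsilon>" "fibre_disc P t \<epsilon>' \<delta>'"
      using fibre_disc_exists[OF deg, of "min e \<epsilon>" t] D.eps by auto
    interpret D': fibre_disc P t \<epsilon>' \<delta>' by (fact D'(2))
    obtain C' where C': "connected C'" "C' \<noteq> {}" "C' \<subseteq> W" "C' \<subseteq> ball t \<delta>' - {t}"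
        "\<forall>\<^sub>F z in ?F. z \<in> C'"
      using arc_tail[OF arc D'.del] by metis
    obtain w where w: "poly P w = t" "g ` C' \<subseteq> ball w \<epsilon>'"
      using D'.branch_ball[OF br C'(1,2,3)] C'(4) by blast
    have "\<forall>\<^sub>F z in ?F. z \<in> C \<and> z \<in> C'" using C(4) C'(5) by (rule eventually_conj)
    then obtain y where "y \<in> C" "y \<in> C'" using eventually_happens'[OF nt] by blast
    then have "g y \<in> ball v \<epsilon>" "g y \<in> ball w \<epsilon>'" using v w by auto
    moreover have "ball w \<epsilon>' \<subseteq> ball w \<epsilon>" using D'(1) by auto
    ultimately have "w = v" using D.sep[OF v(1) w(1)] by blast
    show "\<forall>\<^sub>F x in ?F. dist (g x) v < e"
      using C'(5)
    proof eventually_elim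
      case (elim x)
      then have "g x \<in> ball v \<epsilon>'" using w \<open>w = v\<close> by auto
      then show ?case using D'(1) by (simp add: dist_commute)
    qed
  qed
  have gz: "g z \<in> ball v \<epsilon>" using v z by auto
  show ?thesis
  proof
    assume "(g \<longlongrightarrow> a) ?F"
    then have "a = v" using lim nt tendsto_unique by blast
    then show "g z \<in> ball a \<epsilon>" using gz by simp
  next
    assume "g z \<in> ball a \<epsilon>"
    then have "a = v" using D.sep[OF v(1) a] gz by blast
    then show "(g \<longlongrightarrow> a) ?F" using lim by simp
  qed
qed

lemma branch_has_limit:
  assumes g: "g \<in> branches"
  obtains a where "poly P a = t" "(g \<longlongrightarrow> a) (at t within path_image \<gamma>)"
proof -
  obtain \<epsilon> \<delta> where D: "fibre_disc P t \<epsilon> \<delta>"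
    using fibre_disc_exists[OF deg zero_less_one, of t] by metis
  interpret D: fibre_disc P t \<epsilon> \<delta> by (fact D)
  obtain C where C: "connected C" "C \<noteq> {}" "C \<subseteq> W" "C \<subseteq> ball t \<delta> - {t}"
      "\<forall>\<^sub>F z in at t within path_image \<gamma>. z \<in> C"
    using arc_tail[OF arc D.del] by metis
  have C': "C \<subseteq> ball t \<delta>" using C by blast
  obtain z where z: "z \<in> C" using C by blast
  have br: "inverse_branch P W g" using g by (simp add: branches_def)
  obtain v where v: "poly P v = t" "g ` C \<subseteq> ball v \<epsilon>" using D.branch_ball[OF br C(1,2,3) C'] by blast
  then have "g z \<in> ball v \<epsilon>" using z by auto
  then show ?thesis using that[OF v(1)] branch_tendsto_iff[OF D C(1,3) C' C(5) g v(1) z] by blast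
qed

lemma branches_attached_eq:
  assumes "poly P a = t"
  shows "branches_attached P W \<gamma> a = {g \<in> branches. (g \<longlongrightarrow> a) (at t within path_image \<gamma>)}"
  using assms by (auto simp: branches_attached_def branches_def)

lemma card_branches_attached:
  assumes a: "poly P a = t"
  shows "card (branches_attached P W \<gamma> a) = mult_at P a"
proof -
  let ?F = "at t within path_image \<gamma>"
  have nt: "?F \<noteq> bot" using arc_end_nontrivial arc by blast
  have "\<forall>g\<in>branches. \<exists>v. (g \<longlongrightarrow> v) ?F" using branch_has_limit by blast
  from bchoice[OF this] obtain l where l: "\<And>g. g \<in> branches \<Longrightarrow> (g \<longlongrightarrow> l g) ?F" by blast
  \<comment> \<open>Let \<open>z\<close> tend to \<open>t\<close> in the factorization of \<open>P - z\<close>: the multiplicity of \<open>a\<close> is the number of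
    branches with limit \<open>a\<close>.\<close>
  have ev: "poly P x - t = lead_coeff P * (\<Prod>g\<in>branches. (x - l g))" for x
  proof (rule tendsto_unique[OF nt])
    show "((\<lambda>z. poly P x - z) \<longlongrightarrow> poly P x - t) ?F" by (intro tendsto_intros)
    have "((\<lambda>z. lead_coeff P * (\<Prod>g\<in>branches. (x - g z))) \<longlongrightarrow> lead_coeff P * (\<Prod>g\<in>branches. (x - l g))) ?F"
      using l by (intro tendsto_intros)
    moreover have "\<forall>\<^sub>F z in ?F. lead_coeff P * (\<Prod>g\<in>branches. (x - g z)) = poly P x - z"
    proof -
      have "\<forall>\<^sub>F z in ?F. z \<in> path_image \<gamma> \<and> z \<noteq> t" by (simp add: eventually_at_filter)
      then show ?thesis
      proof eventually_elim
        case (elim z)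
        then have "z \<in> W" using arc by blast
        then show ?case using poly_eq_prod_branches by simp
      qed
    qed
    ultimately show "((\<lambda>z. poly P x - z) \<longlongrightarrow> lead_coeff P * (\<Prod>g\<in>branches. (x - l g))) ?F"
      using Lim_transform_eventually by blast
  qed
  have "P - [:t:] = smult (lead_coeff P) (\<Prod>g\<in>branches. [:- l g, 1:])"
    by (rule poly_eq_poly_eq_iff[THEN iffD1], rule ext) (simp add: poly_prod ev)
  then have "mult_at P a = order a (smult (lead_coeff P) (\<Prod>g\<in>branches. [:- l g, 1:]))"
    by (simp add: mult_at_def a)
  also have "\<dots> = card {g\<in>branches. l g = a}"
    using deg finite_branches by (subst order_smult) (auto simp: order_prod_linear)
  also have "{g\<in>branches. l g = a} = branches_attached P W \<gamma> a"
    using l tendsto_unique[OF nt] by (auto simp: branches_attached_eq[OF a])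
  finally show ?thesis by simp
qed

text \<open>The identity is needed on an open set for analytic continuation, so it is taken on a
  ball about a point \<open>c\<close> of the tail. One ball serves all \<open>Q\<close> and all
  \<open>a\<close> over \<open>t\<close>.\<close>

lemma attached_sum_eq_locsum:
  assumes D: "fibre_disc P t \<epsilon> \<delta>"
  obtains B where "open B" "B \<noteq> {}" "B \<subseteq> W" "B \<subseteq> ball t \<delta> - {t}"
    "\<And>Q a z. poly P a = t \<Longrightarrow> z \<in> B \<Longrightarrow>
       (\<Sum>g\<in>branches_attached P W \<gamma> a. poly Q (g z)) = fibre_disc.locsum P \<epsilon> Q a z"
proof -
  interpret D: fibre_disc P t \<epsilon> \<delta> by (fact D)
  obtain C where C: "connected C" "C \<noteq> {}" "C \<subseteq> W" "C \<subseteq> ball t \<delta> - {t}"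
      "\<forall>\<^sub>F z in at t within path_image \<gamma>. z \<in> C"
    using arc_tail[OF arc D.del] by metis
  have C': "C \<subseteq> ball t \<delta>" using C by blast
  obtain c where c: "c \<in> C" using C by blast
  have "open (W \<inter> (ball t \<delta> - {t}))" using opW by (intro open_Int) (auto intro: open_delete)
  then obtain r where r: "r > 0" "ball c r \<subseteq> W \<inter> (ball t \<delta> - {t})"
    using c C unfolding open_contains_ball by (metis IntI subsetD)
  show ?thesis
  proof (rule that[of "ball c r"])
    fix Q a z assume a: "poly P a = t" and z: "z \<in> ball c r"
    have "branches_attached P W \<gamma> a = {g \<in> branches. g c \<in> ball a \<epsilon>}"
      using branch_tendsto_iff[OF D C(1,3) C' C(5) _ a c] by (auto simp: branches_attached_eq[OF a])
    then show "(\<Sum>g\<in>branches_attached P W \<gamma> a. poly Q (g z)) = D.locsum Q a z"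
      using D.locsum_eq[OF sc_regular_domain_axioms, of "ball c r" c z a Q] r z a
      by (simp add: subset_Diff_insert)
  qed (use r in auto)
qed

end

text \<open>The identity theorem is applied on the punctured disc about \<open>t\<close> and then on
  \<open>V\<close>; the disc links the two domains whether or not they overlap. Weights on several
  points of the fibre allow for the case \<open>P a = P b\<close>, where one relation couples two of
  them.\<close>

lemma relation_transfer:
  assumes U: "ended_domain P U \<gamma> t" and V: "ended_domain P V \<eta> t"
    and A: "\<And>a. a \<in> A \<Longrightarrow> poly P a = t"
    and rel: "\<And>z. z \<in> U \<Longrightarrow> (\<Sum>a\<in>A. c a * (\<Sum>g\<in>branches_attached P U \<gamma> a. poly Q (g z))) = 0"
    and z: "z \<in> V"
  shows "(\<Sum>a\<in>A. c a * (\<Sum>g\<in>branches_attached P V \<eta> a. poly Q (g z))) = 0"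
proof -
  interpret U: ended_domain P U \<gamma> t by (fact U)
  interpret V: ended_domain P V \<eta> t by (fact V)
  obtain \<epsilon> \<delta> where D: "fibre_disc P t \<epsilon> \<delta>"
    using fibre_disc_exists[OF U.deg zero_less_one, of t] by metis
  interpret D: fibre_disc P t \<epsilon> \<delta> by (fact D)
  obtain B where B: "open B" "B \<noteq> {}" "B \<subseteq> U" "B \<subseteq> ball t \<delta> - {t}"
    "\<And>Q a z. poly P a = t \<Longrightarrow> z \<in> B \<Longrightarrow>
       (\<Sum>g\<in>branches_attached P U \<gamma> a. poly Q (g z)) = D.locsum Q a z"
    using U.attached_sum_eq_locsum[OF D] by metis
  obtain B' where B': "open B'" "B' \<noteq> {}" "B' \<subseteq> V" "B' \<subseteq> ball t \<delta> - {t}"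
    "\<And>Q a z. poly P a = t \<Longrightarrow> z \<in> B' \<Longrightarrow>
       (\<Sum>g\<in>branches_attached P V \<eta> a. poly Q (g z)) = D.locsum Q a z"
    using V.attached_sum_eq_locsum[OF D] by metis
  have conn: "connected (ball t \<delta> - {t})"
    by (rule connected_punctured_ball) simp
  have disc: "(\<Sum>a\<in>A. c a * D.locsum Q a z) = 0" if z: "z \<in> ball t \<delta> - {t}" for z
  proof (rule analytic_continuation_open[of B "ball t \<delta> - {t}" _ "\<lambda>_. 0" z])
    show "(\<lambda>z. \<Sum>a\<in>A. c a * D.locsum Q a z) holomorphic_on ball t \<delta> - {t}"
      by (intro holomorphic_intros D.locsum_holomorphic A)
    fix z assume "z \<in> B"
    then show "(\<Sum>a\<in>A. c a * D.locsum Q a z) = 0"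
      using rel[of z] B(3) B(5)[OF A] by (simp add: subset_iff)
  qed (use B conn z in \<open>auto intro: open_delete\<close>)
  show ?thesis
  proof (rule analytic_continuation_open[of B' V _ "\<lambda>_. 0" z])
    show "(\<lambda>z. \<Sum>a\<in>A. c a * (\<Sum>g\<in>branches_attached P V \<eta> a. poly Q (g z))) holomorphic_on V"
      by (intro holomorphic_intros holomorphic_on_compose[OF _ holomorphic_on_poly_fun, unfolded o_def])
         (auto simp: branches_attached_def inverse_branch_def)
    fix z assume "z \<in> B'"
    then show "(\<Sum>a\<in>A. c a * (\<Sum>g\<in>branches_attached P V \<eta> a. poly Q (g z))) = 0"
      using disc[of z] B'(4) B'(5)[OF A] by (simp add: subset_iff)
  qed (use B' V.opW V.conW z in auto)
qed

section \<open>Integer relations between roots of unity\<close>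

text \<open>Galois conjugation is expressed through integer polynomials: a polynomial that vanishes
  at a root of unity vanishes at its powers with exponent coprime to the order.\<close>

definition ieval :: "int poly \<Rightarrow> complex \<Rightarrow> complex" where
  "ieval f z = poly (map_poly of_int f) z"

lemma ieval_0 [simp]: "ieval 0 z = 0"
  by (simp add: ieval_def)

lemma ieval_pCons [simp]: "ieval (pCons a f) z = of_int a + z * ieval f z"
  by (simp add: ieval_def map_poly_pCons)

lemma ieval_1 [simp]: "ieval 1 z = 1"
  by (simp add: one_pCons)

lemma ieval_add [simp]: "ieval (f + g) z = ieval f z + ieval g z"
proof -
  have "map_poly of_int (f + g) = map_poly of_int f + (map_poly of_int g :: complex poly)"
    by (rule poly_eqI) (simp add: coeff_map_poly)
  then show ?thesis by (simp add: ieval_def)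
qed

lemma ieval_smult [simp]: "ieval (smult c f) z = of_int c * ieval f z"
  by (induction f) (simp_all add: algebra_simps)

lemma ieval_diff [simp]: "ieval (f - g) z = ieval f z - ieval g z"
  using ieval_add[of "f - g" g z] by simp

lemma ieval_mult [simp]: "ieval (f * g) z = ieval f z * ieval g z"
  by (induction f) (simp_all add: algebra_simps)

lemma ieval_power [simp]: "ieval (f ^ k) z = ieval f z ^ k"
  by (induction k) simp_all

lemma ieval_monom [simp]: "ieval (monom c k) z = of_int c * z ^ k"
  by (induction k) (simp_all add: monom_0 monom_Suc)

lemma ieval_sum [simp]: "ieval (\<Sum>i\<in>I. f i) z = (\<Sum>i\<in>I. ieval (f i) z)"
  by (induction I rule: infinite_finite_induct) simp_all

lemma ieval_pcompose [simp]: "ieval (pcompose f g) z = ieval f (ieval g z)"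
  by (induction f) (simp_all add: pcompose_pCons)

text \<open>The inner binomial coefficients are divisible by \<open>p\<close>. The ring is left
  general because both integers and integer polynomials occur below.\<close>

lemma dvd_add_power_prime:
  fixes x y :: "'a::comm_ring_1"
  assumes "prime p"
  shows "of_nat p dvd (x + y) ^ p - x ^ p - y ^ p"
proof -
  have p: "p > 0" using assms prime_gt_0_nat by blast
  have eq: "{..p} = insert 0 (insert p {0<..<p})" using p by auto
  have "(x + y) ^ p = (\<Sum>k\<le>p. of_nat (p choose k) * x ^ k * y ^ (p - k))"
    by (rule binomial_ring)
  also have "\<dots> = y ^ p + (x ^ p + (\<Sum>k\<in>{0<..<p}. of_nat (p choose k) * x ^ k * y ^ (p - k)))"
    using p by (simp add: eq)
  finally have "(x + y) ^ p - x ^ p - y ^ p = (\<Sum>k\<in>{0<..<p}. of_nat (p choose k) * x ^ k * y ^ (p - k))"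
    by simp
  also have "of_nat p dvd \<dots>"
  proof (rule dvd_sum)
    fix k assume "k \<in> {0<..<p}"
    then have "p dvd (p choose k)" using assms by (intro dvd_choose_prime) auto
    then obtain q where q: "p choose k = p * q" by (elim dvdE)
    then show "of_nat p dvd (of_nat (p choose k) * x ^ k * y ^ (p - k) :: 'a)"
      unfolding q by (simp add: mult.assoc)
  qed
  finally show ?thesis .
qed

lemma int_power_prime_cong:
  fixes a :: int
  assumes "prime p"
  shows "int p dvd a ^ p - a"
proof -
  have p: "p > 0" using assms prime_gt_0_nat by blast
  have nat: "int p dvd int m ^ p - int m" for m
  proof (induction m)
    case 0 then show ?case using p by (simp add: power_0_left)
  next
    case (Suc m)
    have "int p dvd (int m + 1) ^ p - int m ^ p - 1 ^ p"
      using dvd_add_power_prime[OF assms, of "int m" 1] by simp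
    from dvd_add[OF this Suc.IH] show ?case by (simp add: algebra_simps)
  qed
  have "[a ^ p = (a mod int p) ^ p] (mod int p)" by (intro cong_pow) (simp add: cong_def)
  moreover have "[(a mod int p) ^ p = a mod int p] (mod int p)"
    using nat[of "nat (a mod int p)"] p by (simp add: cong_iff_dvd_diff)
  ultimately have "[a ^ p = a] (mod int p)" by (metis cong_mod_right cong_trans)
  then show ?thesis by (simp add: cong_iff_dvd_diff)
qed

text \<open>Raising to the power \<open>p\<close> is additive modulo \<open>p\<close> and fixes the
  integers modulo \<open>p\<close>, so it acts on a polynomial only through the variable. The three
  divisibilities in the induction step telescope.\<close>

lemma int_poly_frobenius:
  fixes h :: "int poly"
  assumes "prime p"
  shows "[:int p:] dvd h ^ p - pcompose h (monom 1 p)"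
proof (induction h)
  case 0
  then show ?case using prime_gt_0_nat[OF assms] by (simp add: power_0_left)
next
  case (pCons a h)
  have D: "[:int p:] = of_nat p" by (simp add: of_nat_poly)
  have 1: "pCons a h = [:a:] + monom 1 1 * h"
    by (simp add: monom_Suc monom_0)
  have "[:int p:] dvd (pCons a h) ^ p - [:a:] ^ p - (monom 1 1 * h) ^ p"
    unfolding 1 D by (rule dvd_add_power_prime[OF assms])
  moreover have "[:int p:] dvd [:a:] ^ p - [:a:]"
    using int_power_prime_cong[OF assms, of a] by (simp add: poly_const_pow const_poly_dvd_const_poly_iff)
  moreover have "[:int p:] dvd monom 1 p * (h ^ p - pcompose h (monom 1 p))"
    using pCons.IH by (rule dvd_mult)
  ultimately have "[:int p:] dvd ((pCons a h) ^ p - [:a:] ^ p - (monom 1 1 * h) ^ p) +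
       ([:a:] ^ p - [:a:]) + monom 1 p * (h ^ p - pcompose h (monom 1 p))"
    by (intro dvd_add)
  also have "\<dots> = (pCons a h) ^ p - pcompose (pCons a h) (monom 1 p)"
    by (simp add: pcompose_pCons power_mult_distrib monom_power algebra_simps)
  finally show ?case .
qed

text \<open>Gauss's lemma: pseudo-division of \<open>f\<close> by a primitive \<open>m\<close> of
  least degree leaves no remainder, say \<open>a * f = m * q\<close>, and since \<open>m\<close> has
  content 1 the constant \<open>a\<close> divides the content of \<open>q\<close> and
  cancels.\<close>

lemma minimal_int_poly:
  assumes "g \<noteq> 0" "ieval g z = 0"
  obtains m where "m \<noteq> 0" "ieval m z = 0" "\<And>f. ieval f z = 0 \<Longrightarrow> m dvd f"
    "\<And>f. ieval f z = 0 \<Longrightarrow> f \<noteq> 0 \<Longrightarrow> degree m \<le> degree f"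
proof -
  define A where "A = (\<lambda>d. \<exists>f. f \<noteq> 0 \<and> ieval f z = 0 \<and> degree f = d)"
  have "\<exists>d. A d" using assms unfolding A_def by blast
  then have "A (Least A)" by (metis LeastI)
  then obtain m' where m': "m' \<noteq> 0" "ieval m' z = 0" "degree m' = Least A" unfolding A_def by blast
  have least: "degree m' \<le> degree f" if "f \<noteq> 0" "ieval f z = 0" for f
    unfolding m'(3) by (rule Least_le) (use that A_def in blast)
  define m where "m = primitive_part m'"
  have m0: "m \<noteq> 0" "degree m = degree m'" "content m = 1" using m' by (auto simp: m_def)
  have "ieval (smult (content m') m) z = 0" using m' by (simp add: m_def del: ieval_smult)
  then have mz: "ieval m z = 0" using m' by simp
  have dvd: "m dvd f" if f: "ieval f z = 0" for f
  proof -
    define r q where "r = pseudo_mod f m" and "q = fst (pseudo_divmod f m)"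
    obtain a q where aq: "a \<noteq> 0" "smult a f = m * q + r"
      using pseudo_mod(1)[OF m0(1), of f] unfolding r_def by blast
    have "r = 0 \<or> degree r < degree m" using pseudo_mod(2)[OF m0(1), of f] unfolding r_def by blast
    moreover have "ieval r z = 0"
      using arg_cong[OF aq(2), of "\<lambda>p. ieval p z"] f mz by simp
    ultimately have "r = 0" using least[of r] m0(2) by fastforce
    then have eq: "smult a f = m * q" using aq by simp
    then have "content (smult a f) = content q" using m0 by (simp add: content_mult)
    then have "a dvd content q" by (metis content_smult dvd_mult2 dvd_normalize_iff dvd_refl)
    then have "[:a:] dvd q" by (simp add: const_poly_dvd_iff_dvd_content)
    then obtain q' where "q = [:a:] * q'" by (elim dvdE)
    then have "smult a f = smult a (m * q')" using eq by simp
    then have "f = m * q'" using aq(1) by (simp add: smult_cancel)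
    then show ?thesis by simp
  qed
  show ?thesis using that[OF m0(1) mz dvd] least m0(2) by metis
qed

lemma ieval_root_of_unity_prime_power:
  assumes n: "n > 0" "z ^ n = 1" and p: "prime p" "\<not> p dvd n" and f: "ieval f z = 0"
  shows "ieval f (z ^ p) = 0"
proof -
  define X where "X = monom 1 n - (1 :: int poly)"
  have evX: "ieval X w = w ^ n - 1" for w by (simp add: X_def)
  have degX: "degree X = n"
  proof -
    have "degree (monom (1::int) n + (- 1)) = n"
      using n by (subst degree_add_eq_left) (simp_all add: degree_monom_eq)
    then show ?thesis by (simp add: X_def)
  qed
  then have X0: "X \<noteq> 0" using n by auto
  obtain m where m: "m \<noteq> 0" "ieval m z = 0" and mdvd: "\<And>f. ieval f z = 0 \<Longrightarrow> m dvd f"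
    and mdeg: "\<And>f. ieval f z = 0 \<Longrightarrow> f \<noteq> 0 \<Longrightarrow> degree m \<le> degree f"
    using minimal_int_poly[OF X0, of z] n by (auto simp: evX)
  obtain h where h: "X = m * h" using mdvd[of X] n by (auto simp: evX)
  \<comment> \<open>As a factor of a monic polynomial \<open>m\<close> has a unit as leading
    coefficient, so pseudo-division by \<open>m\<close> introduces only a unit factor.\<close>
  have "lead_coeff X = 1"
    using n degX by (simp add: X_def)
  then have lc: "lead_coeff m dvd 1" using h by (metis dvd_triv_left lead_coeff_mult)
  \<comment> \<open>Otherwise \<open>h (z ^ p) = 0\<close>, so \<open>p\<close> divides \<open>h z ^ p\<close> by Frobenius; but \<open>h z\<close> divides \<open>n\<close>, as one sees
    from the derivative of \<open>X = m * h\<close> at \<open>z\<close>, and so \<open>p\<close> would divide \<open>n ^ p\<close>.\<close>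
  have "ieval m (z ^ p) = 0"
  proof (rule ccontr)
    assume mp: "ieval m (z ^ p) \<noteq> 0"
    have "ieval X (z ^ p) = 0" using n by (simp add: evX power_mult[symmetric]) (simp add: mult.commute power_mult)
    with mp h have hp: "ieval h (z ^ p) = 0" by simp
    obtain s where s: "h ^ p - pcompose h (monom 1 p) = [:int p:] * s"
      using int_poly_frobenius[OF p(1), of h] by (elim dvdE)
    have hz: "ieval h z ^ p = of_nat p * ieval s z"
      using arg_cong[OF s, of "\<lambda>p. ieval p z"] hp by simp
    have "pderiv X = m * pderiv h + h * pderiv m" by (simp add: h pderiv_mult)
    moreover have "pderiv X = monom (int n) (n - 1)" by (simp add: X_def pderiv_diff pderiv_monom)
    ultimately have "of_nat n * z ^ (n - 1) = ieval h z * ieval (pderiv m) z"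
      using m(2) by (metis (no_types, lifting) add_0 ieval_add ieval_monom ieval_mult mult_zero_left of_int_of_nat_eq)
    then have "of_nat n * z ^ n = ieval h z * ieval (pderiv m) z * z"
      using n(1) by (cases n) (auto simp: algebra_simps)
    then have "of_nat n = ieval h z * (ieval (pderiv m) z * z)" using n by simp
    then have "of_nat n ^ p = of_nat p * ieval s z * (ieval (pderiv m) z * z) ^ p"
      by (simp only: power_mult_distrib hz)
    also have "\<dots> = of_nat p * ieval (s * (pderiv m * monom 1 1) ^ p) z"
      by simp
    finally obtain w where w: "of_nat n ^ p = of_nat p * ieval w z" by blast
    \<comment> \<open>It remains to pass from divisibility by \<open>p\<close> among the values at
      \<open>z\<close> to divisibility in the integers. After reduction modulo \<open>m\<close> the
      relation has degree below that of \<open>m\<close>, so it holds identically and its constant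
      coefficients can be compared.\<close>
    define r where "r = pseudo_mod w m"
    have deg_m: "degree m > 0"
    proof (rule ccontr)
      assume "\<not> degree m > 0"
      then obtain c where "m = [:c:]" by (metis degree_eq_zeroE gr0I)
      then show False using m by simp
    qed
    obtain q where q: "smult (lead_coeff m ^ (Suc (degree w) - degree m)) w = m * q + r"
      using pseudo_divmod[OF m(1), of w "fst (pseudo_divmod w m)" "snd (pseudo_divmod w m)"]
      unfolding r_def pseudo_mod_def by auto
    define a where "a = lead_coeff m ^ (Suc (degree w) - degree m)"
    have a: "a dvd 1" unfolding a_def using lc by (metis dvd_power_same power_one)
    have "r = 0 \<or> degree r < degree m" using pseudo_mod(2)[OF m(1), of w] unfolding r_def by blast
    then have degr: "degree r < degree m" using deg_m by auto
    define t where "t = smult (int p) r - [:a * int n ^ p:]"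
    have "of_int a * ieval w z = ieval r z"
      using arg_cong[OF q, of "\<lambda>p. ieval p z"] m by (simp add: a_def)
    then have "ieval t z = 0" using w by (simp add: t_def algebra_simps)
    moreover have "degree t < degree m"
      unfolding t_def using degr deg_m by (intro degree_diff_less) (auto intro: le_less_trans[OF degree_smult_le])
    ultimately have "t = 0" using mdeg[of t] by fastforce
    then have "coeff t 0 = 0" by simp
    then have "int p * coeff r 0 = a * int n ^ p" by (simp add: t_def)
    then have "int p dvd a * int n ^ p" by (metis dvd_triv_left)
    also have "a * int n ^ p dvd int n ^ p" using a by (metis dvd_refl mult_dvd_mono mult_1)
    finally have "p dvd n ^ p" by (metis of_nat_dvd_iff of_nat_power)
    then show False using p prime_dvd_power by blast
  qed
  moreover obtain g where "f = m * g" using mdvd[OF f] by (elim dvdE)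
  ultimately show ?thesis by simp
qed

text \<open>Splits off one prime factor of \<open>k\<close> at a time. The induction hypothesis is
  needed at \<open>z ^ p\<close>, which is again an \<open>n\<close>-th root of unity.\<close>

lemma ieval_root_of_unity_power:
  assumes "k > 0" "coprime k n" "n > 0" "z ^ n = 1" "ieval f z = 0"
  shows "ieval f (z ^ k) = 0"
  using assms
proof (induction k arbitrary: z rule: prime_divisors_induct)
  case zero then show ?case by simp
next
  case (unit k)
  then show ?case by simp
next
  case (factor p k)
  have "ieval f (z ^ p) = 0"
    using factor by (intro ieval_root_of_unity_prime_power[of n]) (auto dest: not_coprimeI)
  moreover have "(z ^ p) ^ n = 1" using factor.prems by (metis mult.commute power_mult power_one)
  ultimately have "ieval f ((z ^ p) ^ k) = 0" using factor by (intro factor.IH) auto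
  then show ?case by (simp add: power_mult)
qed

text \<open>All \<open>w i\<close> are powers of one \<open>e\<close>, so the hypothesis says that
  an integer polynomial vanishes at \<open>e powi k\<close>. Raising this root of unity to an
  inverse of \<open>k\<close> modulo \<open>n\<close> leads back to \<open>e\<close>.\<close>

lemma root_of_unity_relation:
  fixes w :: "'i \<Rightarrow> complex" and c :: "'i \<Rightarrow> int" and k :: int
  assumes n: "n > 0" and w: "\<And>i. i \<in> I \<Longrightarrow> w i ^ n = 1" and k: "gcd k (int n) = 1"
    and rel: "(\<Sum>i\<in>I. of_int (c i) * w i powi k) = 0"
  shows "(\<Sum>i\<in>I. of_int (c i) * w i) = 0"
proof -
  define e where "e = exp (2 * of_real pi * \<i> / of_nat n)"
  have en: "e ^ n = 1" using n by (simp add: e_def exp_of_nat_mult[symmetric])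
  have e0: "e \<noteq> 0" by (simp add: e_def)
  have "\<exists>j. z = e ^ j" if "z ^ n = 1" for z
  proof -
    have "z \<in> {z. z ^ n = 1}" using that by simp
    then obtain j where "z = exp (2 * of_real pi * \<i> * of_nat j / of_nat n)"
      using complex_roots_unity[of n] n by auto
    then have "z = e ^ j" by (simp add: e_def exp_of_nat_mult[symmetric] mult_ac)
    then show ?thesis ..
  qed
  then have "\<forall>i\<in>I. \<exists>j. w i = e ^ j" using w by blast
  from bchoice[OF this] obtain j where j: "\<And>i. i \<in> I \<Longrightarrow> w i = e ^ j i" by blast
  obtain l where l: "[k * l = 1] (mod int n)"
    using cong_solve_coprime_int[of k "int n"] k by (auto simp: coprime_iff_gcd_eq_1)
  \<comment> \<open>Adding \<open>n\<close> makes the exponent positive, also for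
    \<open>n = 1\<close>, without changing its residue.\<close>
  define k' where "k' = nat (l mod int n) + n"
  have k': "k' > 0" "[k * int k' = 1] (mod int n)"
    using n l by (auto simp: k'_def cong_def distrib_left mod_mult_right_eq)
  have powi: "e powi a = e powi b" if ab: "[a = b] (mod int n)" for a b
  proof -
    obtain t where "b = a + int n * t" using ab by (auto simp: cong_iff_lin)
    then show ?thesis using en e0 by (simp add: power_int_add power_int_mult)
  qed
  have cop: "coprime k' n"
  proof -
    have "coprime (k * int k') (int n)" using k'(2) by (metis cong_imp_coprime cong_sym coprime_1_left)
    then show ?thesis by simp
  qed
  define f where "f = (\<Sum>i\<in>I. monom (c i) (j i))"
  define z where "z = e powi k"
  have zn: "z ^ n = 1" using powi[of "k * int n" 0] by (simp add: z_def power_int_mult cong_def)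
  have "ieval f z = (\<Sum>i\<in>I. of_int (c i) * w i powi k)"
    unfolding f_def ieval_sum ieval_monom z_def
    by (intro sum.cong refl) (simp add: j power_int_power power_int_power' mult.commute)
  then have "ieval f z = 0" using rel by simp
  then have "ieval f (z ^ k') = 0" using ieval_root_of_unity_power k'(1) cop n zn by blast
  moreover have "z ^ k' = e"
    using powi[OF k'(2)] by (simp add: z_def power_int_mult)
  moreover have "ieval f e = (\<Sum>i\<in>I. of_int (c i) * w i)"
    unfolding f_def ieval_sum ieval_monom by (intro sum.cong refl) (simp add: j)
  ultimately show ?thesis by simp
qed

section \<open>Interlaced points on the unit circle and crossing chords\<close>

lemma cis_eq_imp_eq:
  assumes "cis \<phi> = cis \<psi>" "\<bar>\<phi> - \<psi>\<bar> < 2 * pi"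
  shows "\<phi> = \<psi>"
proof -
  have "cis (\<phi> - \<psi>) = 1" using assms(1) by (simp flip: cis_divide)
  then have "exp (\<i> * of_real (\<phi> - \<psi>)) = 1" by (simp add: cis_conv_exp)
  then obtain k :: int where k: "\<phi> - \<psi> = of_int (2 * k) * pi" by (auto simp: exp_eq_1)
  then have "\<bar>2 * of_int k * pi\<bar> < 2 * pi" using assms(2) by auto
  then have "\<bar>of_int k :: real\<bar> < 1" using pi_gt_zero by (simp add: abs_mult)
  then have "k = 0" by linarith
  then show ?thesis using k by simp
qed

lemma unit_angle_exists:
  assumes "cmod x = 1" "cmod y = 1"
  obtains \<phi> where "0 \<le> \<phi>" "\<phi> < 2 * pi" "x = y * cis \<phi>"
proof -
  have y: "y \<noteq> 0" using assms by auto
  have n: "cmod (x / y) = 1" using assms by (simp add: norm_divide)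
  have "x / y = cis (Arg2pi (x / y))" using Arg2pi_eq[of "x / y"] n by (simp add: cis_conv_exp)
  then have "x = y * cis (Arg2pi (x / y))" using y by (simp add: field_simps)
  then show ?thesis using that[of "Arg2pi (x / y)"] Arg2pi_ge_0[of "x/y"] Arg2pi_lt_2pi[of "x/y"] by blast
qed

lemma interlaced_of_equal_means:
  assumes X: "finite X" "X \<noteq> {}" "\<And>x. x \<in> X \<Longrightarrow> cmod x = 1"
    and Y: "finite Y" "Y \<noteq> {}" "\<And>y. y \<in> Y \<Longrightarrow> cmod y = 1"
    and disj: "X \<inter> Y = {}"
    and mean: "(\<Sum>x\<in>X. x) / of_nat (card X) = (\<Sum>y\<in>Y. y) / of_nat (card Y)"
  obtains \<alpha>1 \<alpha>2 \<beta>1 \<beta>2 where "cis \<alpha>1 \<in> X" "cis \<alpha>2 \<in> X" "cis \<beta>1 \<in> Y" "cis \<beta>2 \<in> Y"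
    "\<beta>1 < \<alpha>1" "\<alpha>1 < \<beta>2" "\<beta>2 < \<alpha>2" "\<alpha>2 < \<beta>1 + 2 * pi"
proof -
  \<comment> \<open>Angles are measured from a point of \<open>Y\<close>; the extreme angles of
    \<open>X\<close> then lie strictly inside the full turn, with \<open>y0\<close> on the arc
    outside them. Only a second point of \<open>Y\<close> between them is missing.\<close>
  obtain y0 where y0: "y0 \<in> Y" using Y by blast
  obtain \<beta>0 where \<beta>0: "y0 = cis \<beta>0"
    using unit_angle_exists[of y0 1] Y(3)[OF y0] by auto
  have "\<exists>\<phi>. 0 \<le> \<phi> \<and> \<phi> < 2 * pi \<and> x = y0 * cis \<phi>" if "x \<in> X \<union> Y" for x
  proof -
    have "cmod x = 1" using that X(3) Y(3) by blast
    from unit_angle_exists[OF this Y(3)[OF y0]] show ?thesis by metis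
  qed
  then have "\<forall>x\<in>X \<union> Y. \<exists>\<phi>. 0 \<le> \<phi> \<and> \<phi> < 2 * pi \<and> x = y0 * cis \<phi>" by blast
  from bchoice[OF this] obtain \<phi> where
    \<phi>: "\<And>x. x \<in> X \<union> Y \<Longrightarrow> 0 \<le> \<phi> x \<and> \<phi> x < 2 * pi \<and> x = y0 * cis (\<phi> x)" by blast
  have cis: "x = cis (\<beta>0 + \<phi> x)" if "x \<in> X \<union> Y" for x
    using \<phi>[OF that] unfolding \<beta>0 cis_mult by blast
  define a1 where "a1 = Min (\<phi> ` X)"
  define a2 where "a2 = Max (\<phi> ` X)"
  have "a1 \<in> \<phi> ` X" unfolding a1_def using X by (intro Min_in) auto
  then obtain x1 where x1: "x1 \<in> X" "\<phi> x1 = a1" by blast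
  have "a2 \<in> \<phi> ` X" unfolding a2_def using X by (intro Max_in) auto
  then obtain x2 where x2: "x2 \<in> X" "\<phi> x2 = a2" by blast
  have aX: "a1 \<le> \<phi> x" "\<phi> x \<le> a2" if "x \<in> X" for x
    using that X by (auto simp: a1_def a2_def)
  have a1: "0 < a1"
  proof -
    have "\<phi> x1 \<noteq> 0"
    proof
      assume "\<phi> x1 = 0"
      then have "x1 = y0" using \<phi>[of x1] x1 by simp
      then show False using disj x1 y0 by blast
    qed
    then show ?thesis using \<phi>[of x1] x1 by auto
  qed
  have a2: "a2 < 2 * pi" using \<phi>[of x2] x2 by auto
  show ?thesis
  proof (cases "\<exists>y\<in>Y. a1 < \<phi> y \<and> \<phi> y < a2")
    case True
    then obtain y where y: "y \<in> Y" "a1 < \<phi> y" "\<phi> y < a2" by blast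
    have "cis (\<beta>0 + a1) \<in> X" "cis (\<beta>0 + a2) \<in> X" "cis (\<beta>0 + \<phi> y) \<in> Y"
      using cis[of x1] cis[of x2] cis[of y] x1 x2 y by auto
    then show ?thesis
      using that[of "\<beta>0 + a1" "\<beta>0 + a2" \<beta>0 "\<beta>0 + \<phi> y"] y a1 a2 y0 \<beta>0 by auto
  next
    case False
    have ne: "\<phi> y \<noteq> a1" "\<phi> y \<noteq> a2" if "y \<in> Y" for y
      using cis[of y] cis[of x1] cis[of x2] x1 x2 disj that by auto
    \<comment> \<open>All of \<open>Y\<close> lies on the open arc from \<open>x2\<close> to \<open>x1\<close>, so the line through \<open>x1\<close> and \<open>x2\<close> separates
      the two means.\<close>
    define m where "m = (a1 + a2) / 2"
    define h where "h = (a2 - a1) / 2"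
    have h: "0 \<le> h" "h < pi" using aX[OF x1(1)] a1 a2 by (auto simp: h_def)
    \<comment> \<open>Projection to the bisector of the arc from \<open>x1\<close> to
      \<open>x2\<close>, equal to \<open>cos h\<close> at both ends. If \<open>X\<close> is a single
      point, then \<open>h = 0\<close> and the separating line is the tangent there.\<close>
    let ?L = "\<lambda>z. Re (z / (y0 * cis m))"
    have y0n: "y0 \<noteq> 0" using Y(3)[OF y0] by auto
    have L: "?L z = cos (\<phi> z - m)" if "z \<in> X \<union> Y" for z
    proof -
      have "z / (y0 * cis m) = cis (\<phi> z) / cis m" using \<phi>[OF that] y0n by (metis mult_divide_mult_cancel_left)
      then show ?thesis by (simp add: cis_divide)
    qed
    have LX: "cos h \<le> ?L x" if "x \<in> X" for x
    proof -
      have "\<bar>\<phi> x - m\<bar> \<le> h" using aX[OF that] by (auto simp: m_def h_def field_simps abs_le_iff)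
      then have "cos h \<le> cos \<bar>\<phi> x - m\<bar>" using h by (intro cos_monotone_0_pi_le) auto
      then show ?thesis using L[of x] that by simp
    qed
    have LY: "?L y < cos h" if "y \<in> Y" for y
    proof -
      have "\<phi> y < a1 \<or> a2 < \<phi> y" using False ne[OF that] that by force
      moreover have "0 \<le> \<phi> y" "\<phi> y < 2 * pi" using \<phi>[of y] that by auto
      ultimately have b: "h < \<bar>\<phi> y - m\<bar>" "\<bar>\<phi> y - m\<bar> < 2 * pi - h"
        using a1 a2 h aX[OF x1(1)] by (auto simp: m_def h_def field_simps abs_if)
      have "cos \<bar>\<phi> y - m\<bar> < cos h"
      proof (cases "\<bar>\<phi> y - m\<bar> \<le> pi")
        case True
        then show ?thesis using b h by (intro cos_monotone_0_pi) auto
      next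
        case False
        then have "cos (2 * pi - \<bar>\<phi> y - m\<bar>) < cos h" using b h by (intro cos_monotone_0_pi) auto
        then show ?thesis by (simp only: cos_2pi_minus)
      qed
      then show ?thesis using L[of y] that by simp
    qed
    have cX: "card X > 0" and cY: "card Y > 0" using X Y by (auto simp: card_gt_0_iff)
    have Lmean: "?L ((\<Sum>x\<in>S. x) / of_nat c) = (\<Sum>x\<in>S. ?L x) / real c" for S c
    proof -
      have "(\<Sum>x\<in>S. x) / of_nat c / (y0 * cis m) = (\<Sum>x\<in>S. x / (y0 * cis m)) / of_real (real c)"
        by (simp add: sum_divide_distrib[symmetric] mult.commute)
      then show ?thesis by (simp only: Re_divide_of_real Re_sum)
    qed
    have "of_nat (card X) * cos h \<le> (\<Sum>x\<in>X. ?L x)"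
      using sum_bounded_below[of X "cos h" ?L] LX by simp
    then have "cos h \<le> ?L ((\<Sum>x\<in>X. x) / of_nat (card X))"
      unfolding Lmean using cX by (simp add: pos_le_divide_eq mult.commute)
    moreover have "(\<Sum>y\<in>Y. ?L y) < of_nat (card Y) * cos h"
      using sum_strict_mono[of Y ?L "\<lambda>_. cos h"] LY Y by simp
    then have "?L ((\<Sum>y\<in>Y. y) / of_nat (card Y)) < cos h"
      unfolding Lmean using cY by (simp add: pos_divide_less_eq mult.commute)
    ultimately show ?thesis using mean by simp
  qed
qed

text \<open>Theta curve: \<open>c\<close> cuts the inside into two regions, bounded by
  \<open>c\<close> together with \<open>c1\<close> and with \<open>c2\<close>. If \<open>d\<close>
  avoided \<open>c\<close>, its interior would stay in one region, whose closure contains only one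
  of the two ends of \<open>d\<close>.\<close>

lemma crossing_chords_meet:
  fixes c1 c2 c d :: "real \<Rightarrow> complex"
  assumes c1: "arc c1" "pathstart c1 = p" "pathfinish c1 = q"
    and c2: "arc c2" "pathstart c2 = p" "pathfinish c2 = q"
    and c1c2: "path_image c1 \<inter> path_image c2 = {p, q}"
    and c: "arc c" "pathstart c = p" "pathfinish c = q"
      "path_image c - {p, q} \<subseteq> inside (path_image c1 \<union> path_image c2)"
    and d: "arc d" "pathstart d = r" "pathfinish d = s"
      "path_image d - {r, s} \<subseteq> inside (path_image c1 \<union> path_image c2)"
    and r: "r \<in> path_image c1 - {p, q}" and s: "s \<in> path_image c2 - {p, q}"
  shows "path_image c \<inter> path_image d \<noteq> {}"
proof
  assume disj: "path_image c \<inter> path_image d = {}"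
  let ?I = "inside (path_image c1 \<union> path_image c2)"
  let ?I1 = "inside (path_image c1 \<union> path_image c)"
  let ?I2 = "inside (path_image c2 \<union> path_image c)"
  have pq: "p \<noteq> q" using c1 arc_distinct_ends by blast
  have I: "?I \<inter> (path_image c1 \<union> path_image c2) = {}" by (rule inside_no_overlap)
  have ends: "p \<in> path_image c" "q \<in> path_image c" "p \<in> path_image c1" "q \<in> path_image c1"
      "p \<in> path_image c2" "q \<in> path_image c2"
    using c1 c2 c by (metis pathstart_in_path_image pathfinish_in_path_image)+
  have c1c: "path_image c1 \<inter> path_image c = {p, q}" and c2c: "path_image c2 \<inter> path_image c = {p, q}"
    using c(4) I ends by blast+
  have cI: "path_image c \<inter> ?I \<noteq> {}" using nonempty_simple_path_endless[OF arc_imp_simple_path[OF c(1)]] c by auto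
  have split: "?I1 \<inter> ?I2 = {}" "?I1 \<union> ?I2 \<union> (path_image c - {p, q}) = ?I"
    using split_inside_simple_closed_curve[OF arc_imp_simple_path[OF c1(1)] c1(2,3)
        arc_imp_simple_path[OF c2(1)] c2(2,3) arc_imp_simple_path[OF c(1)] c(2,3) pq c1c2 c1c c2c cI]
    by blast+
  have opn: "open ?I1" "open ?I2"
    using c1 c2 c by (auto intro!: open_inside closed_Un closed_arc_image)
  define T where "T = path_image d - {r, s}"
  have "connected T" unfolding T_def using connected_simple_path_endless[OF arc_imp_simple_path[OF d(1)]] d by simp
  have T: "T \<subseteq> ?I1 \<union> ?I2" using d(4) split(2) disj unfolding T_def by blast
  have cl: "r \<in> closure T" "s \<in> closure T"
  proof -
    have T': "T = d ` {0<..<1}"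
      unfolding T_def using simple_path_endless[OF arc_imp_simple_path[OF d(1)]] d by simp
    have "d ` closure {0<..<1} \<subseteq> closure T"
    proof (rule image_closure_subset)
      show "continuous_on (closure {0<..<1}) d" using d(1) by (simp add: arc_def path_def)
      show "d ` {0<..<1} \<subseteq> closure T" unfolding T' by (rule closure_subset)
    qed simp
    then have "d 0 \<in> closure T" "d 1 \<in> closure T" by auto
    then show "r \<in> closure T" "s \<in> closure T" using d by (auto simp: pathstart_def pathfinish_def)
  qed
  have front1: "frontier ?I1 \<subseteq> path_image c1 \<union> path_image c" and front2: "frontier ?I2 \<subseteq> path_image c2 \<union> path_image c"
    using c1 c2 c by (auto intro!: frontier_inside_subset closed_Un closed_arc_image)
  have "T \<subseteq> ?I1 \<or> T \<subseteq> ?I2"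
    using connectedD[OF \<open>connected T\<close> opn] T split(1) by blast
  then show False
  proof
    assume "T \<subseteq> ?I1"
    then have "s \<in> closure ?I1" using cl closure_mono by blast
    then have "s \<in> ?I1 \<union> (path_image c1 \<union> path_image c)" using front1 by (auto simp: closure_Un_frontier)
    moreover have "s \<notin> ?I1" using split(2) I s by blast
    moreover have "s \<notin> path_image c1" using s c1c2 by blast
    moreover have "s \<notin> path_image c" using s c2c by blast
    ultimately show False by blast
  next
    assume "T \<subseteq> ?I2"
    then have "r \<in> closure ?I2" using cl closure_mono by blast
    then have "r \<in> ?I2 \<union> (path_image c2 \<union> path_image c)" using front2 by (auto simp: closure_Un_frontier)
    moreover have "r \<notin> ?I2" using split(2) I r by blast
    moreover have "r \<notin> path_image c2" using r c1c2 by blast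
    moreover have "r \<notin> path_image c" using r c1c by blast
    ultimately show False by blast
  qed
qed

section \<open>The uniformizing parameter at infinity\<close>

lemma has_sum_int_imp_sums:
  fixes c :: "int \<Rightarrow> complex"
  assumes x: "x \<noteq> 0" and S: "((\<lambda>k. c k * x powi (- k)) has_sum s) {- int N..}"
  shows "(\<lambda>m. c (int m - int N) * (1 / x) ^ m) sums (s / x ^ N)"
proof -
  have bij: "bij_betw (\<lambda>m. int m - int N) UNIV {- int N..}"
    by (rule bij_betwI[of _ _ _ "\<lambda>k. nat (k + int N)"]) auto
  have "((\<lambda>m. c (int m - int N) * x powi (- (int m - int N))) has_sum s) UNIV"
    using has_sum_reindex_bij_betw[OF bij, of "\<lambda>k. c k * x powi (- k)" s] S by simp
  then have "(\<lambda>m. c (int m - int N) * x powi (- (int m - int N))) sums s"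
    by (rule has_sum_imp_sums)
  then have "(\<lambda>m. c (int m - int N) * x powi (- (int m - int N)) / x ^ N) sums (s / x ^ N)"
    by (rule sums_divide)
  moreover have "c (int m - int N) * x powi (- (int m - int N)) / x ^ N = c (int m - int N) * (1 / x) ^ m" for m
    using x by (simp add: power_int_diff power_int_minus field_simps)
  ultimately show ?thesis by simp
qed

text \<open>The branches near infinity are \<open>z \<mapsto> \<Psi> (\<omega> * r z)\<close> with \<open>\<omega>\<close> an \<open>n\<close>-th root of unity; in the notation
  of \<^const>\<open>inverse_puiseux\<close>, \<open>F j\<close> belongs to the inverse of the \<open>j\<close>-th power of \<^term>\<open>root_unity n\<close>.\<close>

locale infinity_param =
  fixes P Q :: "complex poly" and u :: "int \<Rightarrow> complex" and \<Psi> :: "complex \<Rightarrow> complex" and \<rho> :: real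
  assumes deg: "degree P > 0" and rho: "\<rho> > 0"
    and hol: "\<Psi> holomorphic_on {\<zeta>. \<rho> < cmod \<zeta>}"
    and inj: "inj_on \<Psi> {\<zeta>. \<rho> < cmod \<zeta>}"
    and poly_Psi: "\<And>\<zeta>. \<rho> < cmod \<zeta> \<Longrightarrow> poly P (\<Psi> \<zeta>) = \<zeta> ^ degree P"
    and sums_Psi: "\<And>\<zeta>. \<rho> < cmod \<zeta> \<Longrightarrow>
      (\<lambda>m. u (int m - int (degree Q)) * (1 / \<zeta>) ^ m) sums (poly Q (\<Psi> \<zeta>) / \<zeta> ^ degree Q)"

lemma open_cmod_greater: "open {\<zeta>. \<rho> < cmod \<zeta>}"
  by (intro open_Collect_less continuous_intros)

lemma connected_cmod_greater: "connected {\<zeta>::complex. \<rho> < cmod \<zeta>}"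
proof -
  have "connected (- cball (0::complex) \<rho>)"
    by (rule connected_complement_bounded_convex) (auto simp: DIM_complex)
  moreover have "- cball (0::complex) \<rho> = {\<zeta>. \<rho> < cmod \<zeta>}" by auto
  ultimately show ?thesis by simp
qed

lemma infinity_param_exists:
  assumes deg: "degree P > 0" and pc: "puiseux_coeffs_at_infinity P Q u"
  obtains \<Psi> \<rho> where "infinity_param P Q u \<Psi> \<rho>"
proof -
  define n where "n = degree P"
  define N where "N = degree Q"
  obtain V r F v where ip: "inverse_puiseux P V r F v" and
    QF: "\<And>z. z \<in> V \<Longrightarrow> ((\<lambda>k. u k * root_unity n powi (int 0 * k) * r z powi (- k))
              has_sum poly Q (F 0 z)) {- int N..}"
    using pc deg unfolding puiseux_coeffs_at_infinity_def n_def N_def by blast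
  note parts = ip[unfolded inverse_puiseux_def]
  have V: "open V" using parts by (elim conjE)
  have V_ne: "V \<noteq> {}" using parts by (elim conjE)
  have hol_r: "r holomorphic_on V" using parts by (elim conjE)
  have "\<forall>z\<in>V. r z ^ degree P = z" using parts by (elim conjE)
  then have rn: "\<And>z. z \<in> V \<Longrightarrow> r z ^ n = z" by (simp add: n_def)
  have all: "\<forall>j<degree P. inverse_branch P V (F j) \<and>
      (\<forall>z\<in>V. ((\<lambda>k. v k * root_unity (degree P) powi (int j * k) * r z powi (- k)) has_sum F j z) {-1..})"
    using parts by (elim conjE)
  have br: "inverse_branch P V (F 0)" using all[rule_format, OF deg] by (rule conjunct1)
  have vF: "((\<lambda>k. v k * root_unity n powi (int 0 * k) * r z powi (- k)) has_sum F 0 z) {-1..}" if "z \<in> V" for z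
    using bspec[OF conjunct2[OF all[rule_format, OF deg]] that] unfolding n_def .
  have "\<exists>R\<ge>0. critical_values P \<subseteq> cball 0 R \<and> V \<inter> cball 0 R = {}" using parts by (elim conjE)
  then have V0: "0 \<notin> V" by auto
  have n: "n > 0" using deg n_def by simp
  have r0: "r z \<noteq> 0" if "z \<in> V" for z using rn[OF that] V0 that n by (auto simp: power_0_left)
  have sumF: "(\<lambda>m. v (int m - 1) * (1 / r z) ^ m) sums (F 0 z / r z)" if "z \<in> V" for z
    using has_sum_int_imp_sums[OF r0[OF that], where c=v and s="F 0 z" and N=1] vF[OF that] by simp
  have sumQ: "(\<lambda>m. u (int m - int N) * (1 / r z) ^ m) sums (poly Q (F 0 z) / r z ^ N)" if "z \<in> V" for z
    using has_sum_int_imp_sums[OF r0[OF that], where c=u and s="poly Q (F 0 z)" and N=N] QF[OF that] by simp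
  obtain z0 where z0: "z0 \<in> V" using V_ne by blast
  define \<rho>0 where "\<rho>0 = cmod (r z0)"
  have \<rho>0: "\<rho>0 > 0" using r0[OF z0] by (simp add: \<rho>0_def)
  define A where "A \<xi> = (\<Sum>m. v (int m - 1) * \<xi> ^ m)" for \<xi>
  define B where "B \<xi> = (\<Sum>m. u (int m - int N) * \<xi> ^ m)" for \<xi>
  have in_disc: "cmod \<xi> < cmod (1 / r z0)" if "\<xi> \<in> ball 0 (1/\<rho>0)" for \<xi>
    using that by (simp add: \<rho>0_def norm_divide)
  have sA: "(\<lambda>m. v (int m - 1) * \<xi> ^ m) sums A \<xi>" if "\<xi> \<in> ball 0 (1/\<rho>0)" for \<xi>
    unfolding A_def using powser_inside[OF sums_summable[OF sumF[OF z0]] in_disc[OF that]]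
    by (rule summable_sums)
  have sB: "(\<lambda>m. u (int m - int N) * \<xi> ^ m) sums B \<xi>" if "\<xi> \<in> ball 0 (1/\<rho>0)" for \<xi>
    unfolding B_def using powser_inside[OF sums_summable[OF sumQ[OF z0]] in_disc[OF that]]
    by (rule summable_sums)
  have hA: "A holomorphic_on ball 0 (1/\<rho>0)" using sA by (intro power_series_holomorphic) auto
  have hB: "B holomorphic_on ball 0 (1/\<rho>0)" using sB by (intro power_series_holomorphic) auto
  define S where "S = {\<zeta>. \<rho>0 < cmod \<zeta>}"
  have S: "open S" "connected S" unfolding S_def by (rule open_cmod_greater connected_cmod_greater)+
  have S0: "\<zeta> \<noteq> 0" "1 / \<zeta> \<in> ball 0 (1/\<rho>0)" if "\<zeta> \<in> S" for \<zeta>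
  proof -
    have "0 < cmod \<zeta>" using that \<rho>0 by (auto simp: S_def)
    then show "\<zeta> \<noteq> 0" "1 / \<zeta> \<in> ball 0 (1/\<rho>0)"
      using that \<rho>0 by (auto simp: S_def norm_divide frac_less2)
  qed
  define \<Psi> where "\<Psi> \<zeta> = \<zeta> * A (1 / \<zeta>)" for \<zeta>
  have hinv: "(\<lambda>\<zeta>. 1 / \<zeta>) holomorphic_on S" using S0 by (intro holomorphic_intros) auto
  have inv_sub: "(\<lambda>\<zeta>. 1 / \<zeta>) ` S \<subseteq> ball 0 (1/\<rho>0)" using S0(2) by blast
  have hA': "(\<lambda>\<zeta>. A (1 / \<zeta>)) holomorphic_on S"
    using holomorphic_on_compose_gen[OF hinv hA inv_sub] by (simp add: o_def)
  have hB': "(\<lambda>\<zeta>. B (1 / \<zeta>)) holomorphic_on S"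
    using holomorphic_on_compose_gen[OF hinv hB inv_sub] by (simp add: o_def)
  have h\<Psi>: "\<Psi> holomorphic_on S" unfolding \<Psi>_def by (intro holomorphic_intros hA')
  \<comment> \<open>For such \<open>z\<close> the point \<open>1 / r z\<close> lies strictly inside
    the disc of convergence. Since \<open>V\<close> is open, moving outwards from \<open>z0\<close>
    shows that there are such points.\<close>
  define V' where "V' = V \<inter> {z. cmod z0 < cmod z}"
  have opV': "open V'" unfolding V'_def using V open_cmod_greater by blast
  have "V' \<noteq> {}"
  proof -
    obtain e where e: "e > 0" "ball z0 e \<subseteq> V" using V z0 open_contains_ball by blast
    have z0n: "z0 \<noteq> 0" using z0 V0 by blast
    define x where "x = e / (2 * cmod z0)"
    have x: "x > 0" "cmod z0 * x = e / 2" using e z0n by (auto simp: x_def)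
    define z where "z = z0 * of_real (1 + x)"
    have "z - z0 = z0 * of_real x" by (simp add: z_def algebra_simps)
    then have "cmod (z - z0) = e / 2" using x by (simp add: norm_mult)
    then have "z \<in> ball z0 e" using e by (simp add: dist_norm norm_minus_commute)
    moreover have "cmod z = cmod z0 * (1 + x)"
      unfolding z_def norm_mult norm_of_real using x by simp
    then have "cmod z > cmod z0" using x z0n by (simp add: algebra_simps)
    ultimately show ?thesis using e by (auto simp: V'_def)
  qed
  have rS: "r z \<in> S" if "z \<in> V'" for z
  proof -
    have "cmod (r z0) ^ n < cmod (r z) ^ n"
      using that rn[of z] rn[OF z0] by (simp add: V'_def flip: norm_power)
    then show ?thesis unfolding S_def \<rho>0_def using power_less_imp_less_base by fastforce
  qed
  have op: "open (r ` V')"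
  proof (rule open_mapping_thm3)
    show "r holomorphic_on V'" using hol_r by (auto simp: V'_def intro: holomorphic_on_subset)
    show "inj_on r V'" by (rule inj_on_inverseI[of _ "\<lambda>x. x ^ n"]) (use rn V'_def in auto)
  qed (fact opV')
  have rF: "\<Psi> (r z) = F 0 z" "poly Q (F 0 z) = r z ^ N * B (1 / r z)" if "z \<in> V'" for z
  proof -
    have zV: "z \<in> V" using that V'_def by auto
    have "A (1 / r z) = F 0 z / r z" using sums_unique2[OF sA[OF S0(2)[OF rS[OF that]]] sumF[OF zV]] .
    then show "\<Psi> (r z) = F 0 z" using r0[OF zV] by (simp add: \<Psi>_def)
    have "B (1 / r z) = poly Q (F 0 z) / r z ^ N" using sums_unique2[OF sB[OF S0(2)[OF rS[OF that]]] sumQ[OF zV]] .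
    then show "poly Q (F 0 z) = r z ^ N * B (1 / r z)" using r0[OF zV] by simp
  qed
  have P\<Psi>: "poly P (\<Psi> \<zeta>) = \<zeta> ^ n" if "\<zeta> \<in> S" for \<zeta>
  proof (rule analytic_continuation_open[of "r ` V'" S "\<lambda>\<zeta>. poly P (\<Psi> \<zeta>)" "\<lambda>\<zeta>. \<zeta> ^ n"])
    show "(\<lambda>\<zeta>. poly P (\<Psi> \<zeta>)) holomorphic_on S"
      using holomorphic_on_compose[OF h\<Psi> holomorphic_on_poly_fun[of P]] by (simp add: o_def)
    fix \<zeta> assume "\<zeta> \<in> r ` V'"
    then obtain z where z: "z \<in> V'" "\<zeta> = r z" by blast
    then have "z \<in> V" by (simp add: V'_def)
    then show "poly P (\<Psi> \<zeta>) = \<zeta> ^ n"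
      using z rF(1)[of z] rn[of z] br by (simp add: inverse_branch_def)
  qed (use op S \<open>V' \<noteq> {}\<close> rS that in \<open>auto intro: holomorphic_intros\<close>)
  have Q\<Psi>: "poly Q (\<Psi> \<zeta>) = \<zeta> ^ N * B (1 / \<zeta>)" if "\<zeta> \<in> S" for \<zeta>
  proof (rule analytic_continuation_open[of "r ` V'" S "\<lambda>\<zeta>. poly Q (\<Psi> \<zeta>)" "\<lambda>\<zeta>. \<zeta> ^ N * B (1 / \<zeta>)"])
    show "(\<lambda>\<zeta>. poly Q (\<Psi> \<zeta>)) holomorphic_on S"
      using holomorphic_on_compose[OF h\<Psi> holomorphic_on_poly_fun[of Q]] by (simp add: o_def)
    show "(\<lambda>\<zeta>. \<zeta> ^ N * B (1 / \<zeta>)) holomorphic_on S" by (intro holomorphic_intros hB')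
    fix \<zeta> assume "\<zeta> \<in> r ` V'"
    then obtain z where z: "z \<in> V'" "\<zeta> = r z" by blast
    then show "poly Q (\<Psi> \<zeta>) = \<zeta> ^ N * B (1 / \<zeta>)" using rF[of z] by simp
  qed (use op S \<open>V' \<noteq> {}\<close> rS that in auto)
  have b0: "(0::complex) \<in> ball 0 (1/\<rho>0)" using \<rho>0 by simp
  obtain A' where A': "(A has_field_derivative A') (at 0)"
    using hA b0 by (meson holomorphic_on_open open_ball)
  \<comment> \<open>Otherwise \<open>\<Psi> (1 / \<xi>) = A \<xi> / \<xi>\<close> would stay bounded
    as \<open>\<xi>\<close> tends to 0, and \<open>\<xi> ^ n * P (\<Psi> (1 / \<xi>))\<close>, which
    is constantly 1, would tend to 0.\<close>
  have A0: "A 0 \<noteq> 0"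
  proof
    assume "A 0 = 0"
    then have "((\<lambda>\<xi>. A \<xi> / \<xi>) \<longlongrightarrow> A') (at 0)" using A' by (simp add: has_field_derivative_iff)
    then have "((\<lambda>\<xi>. \<xi> ^ n * poly P (A \<xi> / \<xi>)) \<longlongrightarrow> 0 ^ n * poly P A') (at 0)"
      by (intro tendsto_intros) auto
    then have "((\<lambda>\<xi>. \<xi> ^ n * poly P (A \<xi> / \<xi>)) \<longlongrightarrow> 0) (at 0)" using n by (simp add: power_0_left)
    moreover have "\<forall>\<^sub>F \<xi> in at 0. \<xi> ^ n * poly P (A \<xi> / \<xi>) = 1"
    proof -
      have "\<forall>\<^sub>F \<xi>::complex in at 0. \<xi> \<in> ball 0 (1/\<rho>0) - {0}"
        by (rule eventually_at_in_open[OF open_ball b0])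
      then show ?thesis
      proof eventually_elim
        case (elim \<xi>)
        then have "1 / \<xi> \<in> S" using \<rho>0 by (auto simp: S_def norm_divide field_simps)
        from P\<Psi>[OF this] have "poly P (A \<xi> / \<xi>) = (1 / \<xi>) ^ n" by (simp add: \<Psi>_def)
        then show ?case using elim by (simp add: field_simps)
      qed
    qed
    ultimately have "((\<lambda>\<xi>::complex. 1::complex) \<longlongrightarrow> 0) (at 0)"
      by (rule Lim_transform_eventually)
    then show False by (simp add: tendsto_const_iff)
  qed
  define D where "D = {\<xi> \<in> ball 0 (1/\<rho>0). A \<xi> \<noteq> 0}"
  have D: "open D" "0 \<in> D"
  proof -
    have "D = ball 0 (1/\<rho>0) \<inter> A -` (- {0})" by (auto simp: D_def)
    moreover have "open (ball 0 (1/\<rho>0) \<inter> A -` (- {0}))"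
      by (rule continuous_open_preimage[OF holomorphic_on_imp_continuous_on[OF hA]]) auto
    ultimately show "open D" by simp
    show "0 \<in> D" using b0 A0 by (simp add: D_def)
  qed
  \<comment> \<open>This is \<open>1 / \<Psi>\<close> in the coordinate
    \<open>\<xi> = 1 / \<zeta>\<close> at infinity. Its derivative \<open>1 / A 0\<close> at 0 makes
    it locally injective, which gives injectivity of \<open>\<Psi>\<close> near infinity.\<close>
  define h where "h \<xi> = \<xi> / A \<xi>" for \<xi>
  have hh: "h holomorphic_on D"
    unfolding h_def by (intro holomorphic_intros holomorphic_on_subset[OF hA]) (auto simp: D_def)
  have "(h has_field_derivative (1 * A 0 - 0 * A') / (A 0 * A 0)) (at 0)"
    unfolding h_def by (rule DERIV_divide[OF DERIV_ident A' A0])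
  then have dh: "deriv h 0 \<noteq> 0" using A0 by (auto dest: DERIV_imp_deriv)
  obtain d where d: "d > 0" "ball 0 d \<subseteq> D" "inj_on h (ball 0 d)"
    using has_complex_derivative_locally_injective[OF hh D(2,1) dh] by blast
  define \<rho> where "\<rho> = max \<rho>0 (1 / d)"
  have sub: "{\<zeta>. \<rho> < cmod \<zeta>} \<subseteq> S" by (auto simp: S_def \<rho>_def)
  have "infinity_param P Q u \<Psi> \<rho>"
  proof
    show "inj_on \<Psi> {\<zeta>. \<rho> < cmod \<zeta>}"
    proof (rule inj_onI)
      fix x y assume xy: "x \<in> {\<zeta>. \<rho> < cmod \<zeta>}" "y \<in> {\<zeta>. \<rho> < cmod \<zeta>}" "\<Psi> x = \<Psi> y"
      have b: "1 / x \<in> ball 0 d" "1 / y \<in> ball 0 d"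
      proof -
        have "1 / w \<in> ball 0 d" if "\<rho> < cmod w" for w
        proof -
          have "1 / d < cmod w" using that by (simp add: \<rho>_def)
          moreover have "0 < cmod w" using that \<rho>0 by (auto simp: \<rho>_def)
          ultimately show ?thesis using d(1) by (simp add: norm_divide divide_less_eq mult.commute)
        qed
        then show "1 / x \<in> ball 0 d" "1 / y \<in> ball 0 d" using xy by auto
      qed
      have "h (1 / w) = 1 / \<Psi> w" for w by (simp add: h_def \<Psi>_def)
      then have "h (1 / x) = h (1 / y)" using xy by simp
      then have "1 / x = 1 / y" using inj_onD[OF d(3)] b by blast
      then show "x = y" by simp
    qed
    fix \<zeta> assume "\<rho> < cmod \<zeta>"
    then have \<zeta>: "\<zeta> \<in> S" using sub by blast
    show "poly P (\<Psi> \<zeta>) = \<zeta> ^ degree P" using P\<Psi>[OF \<zeta>] n_def by simp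
    show "(\<lambda>m. u (int m - int (degree Q)) * (1 / \<zeta>) ^ m) sums (poly Q (\<Psi> \<zeta>) / \<zeta> ^ degree Q)"
      using sB[OF S0(2)[OF \<zeta>]] Q\<Psi>[OF \<zeta>] S0(1)[OF \<zeta>] by (simp add: N_def)
  qed (use deg \<rho>0 holomorphic_on_subset[OF h\<Psi> sub] in \<open>auto simp: \<rho>_def\<close>)
  then show ?thesis by (rule that)
qed

section \<open>Fibres and level curves near infinity\<close>

context infinity_param
begin

text \<open>By injectivity of \<open>\<Psi>\<close> the points
  \<open>\<Psi> (\<omega> * \<zeta>)\<close> are \<open>n\<close> distinct preimages, and there
  cannot be more.\<close>

lemma preimage_form:
  assumes \<zeta>: "\<rho> < cmod \<zeta>" and w: "poly P w = \<zeta> ^ degree P"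
  obtains \<omega> where "\<omega> ^ degree P = 1" "w = \<Psi> (\<omega> * \<zeta>)"
proof -
  let ?n = "degree P"
  let ?R = "{\<omega>::complex. \<omega> ^ ?n = 1}"
  have z0: "\<zeta> \<noteq> 0" using \<zeta> rho by auto
  have large: "\<rho> < cmod (\<omega> * \<zeta>)" if "\<omega> \<in> ?R" for \<omega>
  proof -
    have "cmod \<omega> = 1" using power_eq_1_iff[of \<omega> ?n] that deg by simp
    then show ?thesis using \<zeta> by (simp add: norm_mult)
  qed
  have "inj_on (\<lambda>\<omega>. \<Psi> (\<omega> * \<zeta>)) ?R"
  proof (rule inj_onI)
    fix x y assume xy: "x \<in> ?R" "y \<in> ?R" "\<Psi> (x * \<zeta>) = \<Psi> (y * \<zeta>)"
    then have "x * \<zeta> = y * \<zeta>" using inj_onD[OF inj xy(3)] large by blast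
    then show "x = y" using z0 by simp
  qed
  then have "card ((\<lambda>\<omega>. \<Psi> (\<omega> * \<zeta>)) ` ?R) = ?n"
    using deg by (simp add: card_image card_roots_unity_eq)
  moreover have "(\<lambda>\<omega>. \<Psi> (\<omega> * \<zeta>)) ` ?R \<subseteq> {w. poly P w = \<zeta> ^ ?n}"
    using poly_Psi[OF large] by (auto simp: power_mult_distrib)
  moreover have "card {w. poly P w = \<zeta> ^ ?n} \<le> ?n"
  proof -
    have "card {w. poly (P - [:\<zeta> ^ ?n:]) w = 0} \<le> degree (P - [:\<zeta> ^ ?n:])"
      by (rule card_poly_roots_bound) (rule poly_minus_const_neq_0[OF deg])
    then show ?thesis by (simp add: poly_minus_const_neq_0[OF deg])
  qed
  ultimately have "(\<lambda>\<omega>. \<Psi> (\<omega> * \<zeta>)) ` ?R = {w. poly P w = \<zeta> ^ ?n}"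
    by (intro card_seteq finite_poly_fibre deg) auto
  then have "w \<in> (\<lambda>\<omega>. \<Psi> (\<omega> * \<zeta>)) ` ?R" using w by simp
  then show ?thesis using that by blast
qed

lemma bounded_sublevel: "bounded {w. cmod (poly P w) \<le> M}"
proof -
  obtain a p where P: "P = pCons a p" by (cases P)
  have "p \<noteq> 0" using deg P by auto
  then obtain b where b: "\<And>z. b \<le> cmod z \<Longrightarrow> M + 1 \<le> cmod (poly P z)"
    using poly_infinity[of p "M + 1" a] P by blast
  show ?thesis
    unfolding bounded_iff
  proof (intro exI ballI)
    fix w assume "w \<in> {w. cmod (poly P w) \<le> M}"
    then show "cmod w \<le> b" using b[of w] by force
  qed
qed

text \<open>Two legs joined at their common start form one chord of the level curve, which is the
  injective image of the circle of radius \<open>s\<close> under \<open>\<Psi>\<close>.\<close>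

lemma no_interlaced_legs:
  assumes s: "\<rho> < s" and lt: "\<beta>1 < \<alpha>1" "\<alpha>1 < \<beta>2" "\<beta>2 < \<alpha>2" "\<alpha>2 < \<beta>1 + 2 * pi"
    and x1: "arc x1" "pathstart x1 = a" "pathfinish x1 = \<Psi> (s * cis \<alpha>1)"
    and x2: "arc x2" "pathstart x2 = a" "pathfinish x2 = \<Psi> (s * cis \<alpha>2)"
    and xx: "path_image x1 \<inter> path_image x2 \<subseteq> {a}"
    and y1: "arc y1" "pathstart y1 = b" "pathfinish y1 = \<Psi> (s * cis \<beta>1)"
    and y2: "arc y2" "pathstart y2 = b" "pathfinish y2 = \<Psi> (s * cis \<beta>2)"
    and yy: "path_image y1 \<inter> path_image y2 \<subseteq> {b}"
    and inx: "\<And>e w. e \<in> {x1, x2, y1, y2} \<Longrightarrow> w \<in> path_image e \<Longrightarrow> w \<noteq> pathfinish e \<Longrightarrow> cmod (poly P w) < s ^ degree P"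
  shows "(path_image x1 \<union> path_image x2) \<inter> (path_image y1 \<union> path_image y2) \<noteq> {}"
proof -
  define f where "f \<phi> = \<Psi> (s * cis \<phi>)" for \<phi>
  have s0: "s > 0" using s rho by simp
  have large: "\<rho> < cmod (s * cis \<phi>)" for \<phi> using s s0 by (simp add: norm_mult)
  have conf: "continuous_on A f" for A
    unfolding f_def by (intro continuous_on_compose2[OF holomorphic_on_imp_continuous_on[OF hol]] continuous_intros) (use large in auto)
  have Pf: "cmod (poly P (f \<phi>)) = s ^ degree P" for \<phi>
    unfolding f_def poly_Psi[OF large] using s0 by (simp add: norm_power norm_mult)
  have f_eq: "cis \<phi> = cis \<psi>" if "f \<phi> = f \<psi>" for \<phi> \<psi>
    using inj_onD[OF inj, of "s * cis \<phi>" "s * cis \<psi>"] large that s0 unfolding f_def by auto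
  have f_inj: "\<phi> = \<psi>" if "f \<phi> = f \<psi>" "\<bar>\<phi> - \<psi>\<bar> < 2 * pi" for \<phi> \<psi>
    using cis_eq_imp_eq[OF f_eq[OF that(1)] that(2)] .
  have f_per: "f (\<phi> + 2 * pi) = f \<phi>" for \<phi> by (simp add: f_def cis_mult[symmetric])
  have arc_f: "arc (\<lambda>x. f (\<phi> + x * (\<psi> - \<phi>)))" if "\<phi> \<noteq> \<psi>" "\<bar>\<phi> - \<psi>\<bar> < 2 * pi" for \<phi> \<psi>
    unfolding arc_def path_def
  proof
    show "continuous_on {0..1} (\<lambda>x. f (\<phi> + x * (\<psi> - \<phi>)))"
      by (intro continuous_on_compose2[OF conf[of UNIV]] continuous_intros) auto
    show "inj_on (\<lambda>x. f (\<phi> + x * (\<psi> - \<phi>))) {0..1}"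
    proof (rule inj_onI)
      fix x y :: real assume xy: "x \<in> {0..1}" "y \<in> {0..1}" "f (\<phi> + x * (\<psi> - \<phi>)) = f (\<phi> + y * (\<psi> - \<phi>))"
      have "\<bar>(\<phi> + x * (\<psi> - \<phi>)) - (\<phi> + y * (\<psi> - \<phi>))\<bar> = \<bar>x - y\<bar> * \<bar>\<phi> - \<psi>\<bar>"
        by (simp add: abs_mult[symmetric] algebra_simps abs_minus_commute)
      also have "\<dots> \<le> 1 * \<bar>\<phi> - \<psi>\<bar>" using xy by (intro mult_right_mono) auto
      also have "\<dots> < 2 * pi" using that(2) by simp
      finally have "\<phi> + x * (\<psi> - \<phi>) = \<phi> + y * (\<psi> - \<phi>)" by (rule f_inj[OF xy(3)])
      then show "x = y" using that by simp
    qed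
  qed
  have im_f: "path_image (\<lambda>x. f (\<phi> + x * (\<psi> - \<phi>))) = f ` closed_segment \<phi> \<psi>" for \<phi> \<psi>
    unfolding path_image_def closed_segment_image_interval image_image
    by (intro image_cong refl arg_cong[where f=f]) (simp add: algebra_simps)
  define c1 where "c1 = (\<lambda>x. f (\<alpha>1 + x * (\<alpha>2 - \<alpha>1)))"
  \<comment> \<open>Traversed backwards, so that both arcs lead from \<open>p\<close> to
    \<open>q\<close>. With the full turn added, \<open>\<beta>1 + 2 * pi\<close> lies in its
    parameter range, while \<open>\<beta>2\<close> lies in that of \<open>c1\<close>.\<close>
  define c2 where "c2 = (\<lambda>x. f ((\<alpha>1 + 2 * pi) + x * (\<alpha>2 - (\<alpha>1 + 2 * pi))))"
  define p where "p = f \<alpha>1"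
  define q where "q = f \<alpha>2"
  have c1: "arc c1" "pathstart c1 = p" "pathfinish c1 = q" "path_image c1 = f ` {\<alpha>1..\<alpha>2}"
    using lt arc_f[of \<alpha>1 \<alpha>2] im_f[of \<alpha>1 \<alpha>2]
    by (auto simp: c1_def p_def q_def pathstart_def pathfinish_def closed_segment_eq_real_ivl)
  have c2: "arc c2" "pathstart c2 = p" "pathfinish c2 = q" "path_image c2 = f ` {\<alpha>2..\<alpha>1 + 2 * pi}"
    using lt arc_f[of "\<alpha>1 + 2 * pi" \<alpha>2] im_f[of "\<alpha>1 + 2 * pi" \<alpha>2] f_per[of \<alpha>1]
    by (auto simp: c2_def p_def q_def pathstart_def pathfinish_def closed_segment_eq_real_ivl)
  have c1c2: "path_image c1 \<inter> path_image c2 = {p, q}"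
  proof
    show "{p, q} \<subseteq> path_image c1 \<inter> path_image c2"
      using c1(1-3) c2(1-3) by (metis Int_iff empty_subsetI insert_subset pathfinish_in_path_image pathstart_in_path_image)
    show "path_image c1 \<inter> path_image c2 \<subseteq> {p, q}"
    proof
      fix w assume "w \<in> path_image c1 \<inter> path_image c2"
      then have "w \<in> f ` {\<alpha>1..\<alpha>2}" "w \<in> f ` {\<alpha>2..\<alpha>1 + 2 * pi}" using c1(4) c2(4) by auto
      then obtain \<phi> \<psi> where "w = f \<phi>" "w = f \<psi>" "\<phi> \<in> {\<alpha>1..\<alpha>2}" "\<psi> \<in> {\<alpha>2..\<alpha>1 + 2 * pi}"
        by blast
      then have w: "w = f \<phi>" "w = f \<psi>" "\<alpha>1 \<le> \<phi>" "\<phi> \<le> \<alpha>2" "\<alpha>2 \<le> \<psi>" "\<psi> \<le> \<alpha>1 + 2 * pi"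
        by simp_all
      show "w \<in> {p, q}"
      \<comment> \<open>Equal points have equal parameters unless these differ by a full turn, which
        happens only for \<open>\<alpha>1\<close> and \<open>\<alpha>1 + 2 * pi\<close>.\<close>
      proof (cases "\<psi> - \<phi> < 2 * pi")
        case True
        then have "\<phi> = \<psi>" using f_inj[of \<phi> \<psi>] w by auto
        then have "\<phi> = \<alpha>2" using w by simp
        then show ?thesis using w q_def by simp
      next
        case False
        then have "\<phi> = \<alpha>1" using w by linarith
        then show ?thesis using w p_def by simp
      qed
    qed
  qed
  let ?S = "path_image c1 \<union> path_image c2"
  have S: "?S = {w. cmod (poly P w) = s ^ degree P}"
  proof
    show "?S \<subseteq> {w. cmod (poly P w) = s ^ degree P}" using c1(4) c2(4) Pf by auto
    show "{w. cmod (poly P w) = s ^ degree P} \<subseteq> ?S"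
    proof
      fix w assume "w \<in> {w. cmod (poly P w) = s ^ degree P}"
      then have w: "cmod (poly P w) = s ^ degree P" by simp
      obtain \<zeta> where \<zeta>: "\<zeta> ^ degree P = poly P w" using exists_complex_root[of "degree P" "poly P w"] deg by (metis not_less_zero)
      have "cmod \<zeta> ^ degree P = s ^ degree P" using w \<zeta> by (simp flip: norm_power)
      then have n\<zeta>: "cmod \<zeta> = s" using s0 deg by (metis less_imp_le norm_ge_zero power_eq_iff_eq_base)
      then obtain \<omega> where \<omega>: "\<omega> ^ degree P = 1" "w = \<Psi> (\<omega> * \<zeta>)"
        using preimage_form[of \<zeta> w] s \<zeta> by metis
      have "(\<omega> * \<zeta>) ^ degree P = poly P w" using \<omega> \<zeta> by (simp add: power_mult_distrib)
      then have "cmod (\<omega> * \<zeta>) ^ degree P = s ^ degree P" using w by (simp flip: norm_power)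
      then have n2: "cmod (\<omega> * \<zeta>) = s" using s0 deg by (metis less_imp_le norm_ge_zero power_eq_iff_eq_base)
      then have "cmod (\<omega> * \<zeta> / s) = 1" using s0 by (simp add: norm_divide)
      then obtain \<phi> where \<phi>: "0 \<le> \<phi>" "\<phi> < 2 * pi" "\<omega> * \<zeta> / s = cis \<alpha>1 * cis \<phi>"
        using unit_angle_exists[of "\<omega> * \<zeta> / s" "cis \<alpha>1"] by auto
      then have "\<omega> * \<zeta> = s * cis (\<alpha>1 + \<phi>)" using s0 by (simp add: cis_mult field_simps)
      then have "w = f (\<alpha>1 + \<phi>)" using \<omega> by (simp add: f_def)
      moreover have "\<alpha>1 + \<phi> \<in> {\<alpha>1..\<alpha>2} \<union> {\<alpha>2..\<alpha>1 + 2 * pi}" using \<phi> by auto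
      ultimately show "w \<in> ?S" using c1(4) c2(4) by blast
    qed
  qed
  \<comment> \<open>A connected set that avoids the level curve cannot leave the sublevel set, by
    the intermediate value theorem for \<open>|P|\<close>, and sublevel sets are bounded.\<close>
  have inside: "w \<in> inside ?S" if w: "cmod (poly P w) < s ^ degree P" for w
  proof -
    let ?C = "connected_component_set (- ?S) w"
    have "?C \<subseteq> {v. cmod (poly P v) \<le> s ^ degree P}"
    proof (rule ccontr)
      assume "\<not> ?thesis"
      then obtain v where "v \<in> ?C" "v \<notin> {v. cmod (poly P v) \<le> s ^ degree P}" by blast
      then have v: "v \<in> ?C" "cmod (poly P v) > s ^ degree P" by simp_all
      have "connected ?C" by (rule connected_connected_component)
      then have "connected ((\<lambda>v. cmod (poly P v)) ` ?C)"
        by (intro connected_continuous_image continuous_intros)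
      moreover have "w \<in> ?C" using w S by (auto intro!: connected_component_refl)
      ultimately have "s ^ degree P \<in> (\<lambda>v. cmod (poly P v)) ` ?C"
        using v w by (meson connectedD_interval imageI less_imp_le)
      then obtain x where "x \<in> ?C" "cmod (poly P x) = s ^ degree P" by auto
      then show False using connected_component_subset[of "- ?S" w] S by auto
    qed
    then have "bounded ?C" using bounded_sublevel bounded_subset by blast
    moreover have "w \<notin> ?S" using w S by auto
    ultimately show ?thesis unfolding inside_def by blast
  qed
  have chord: "arc (reversepath e1 +++ e2)" "path_image (reversepath e1 +++ e2) = path_image e1 \<union> path_image e2"
      "path_image e1 \<union> path_image e2 - {pathfinish e1, pathfinish e2} \<subseteq> inside ?S"
    if "arc e1" "arc e2" "pathstart e1 = v" "pathstart e2 = v" "path_image e1 \<inter> path_image e2 \<subseteq> {v}"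
      "e1 \<in> {x1, x2, y1, y2}" "e2 \<in> {x1, x2, y1, y2}" for e1 e2 v
  proof -
    show "arc (reversepath e1 +++ e2)"
      using that by (intro arc_join) (auto simp: arc_reversepath)
    show "path_image (reversepath e1 +++ e2) = path_image e1 \<union> path_image e2"
      using that by (simp add: path_image_join)
    show "path_image e1 \<union> path_image e2 - {pathfinish e1, pathfinish e2} \<subseteq> inside ?S"
      using inside inx[OF that(6)] inx[OF that(7)] by blast
  qed
  define c where "c = reversepath x1 +++ x2"
  define d where "d = reversepath y2 +++ y1"
  have c: "arc c" "pathstart c = p" "pathfinish c = q" "path_image c - {p, q} \<subseteq> inside ?S"
    "path_image c = path_image x1 \<union> path_image x2"
    using chord[OF x1(1) x2(1) x1(2) x2(2) xx] x1 x2 by (auto simp: c_def p_def q_def f_def)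
  have yy': "path_image y2 \<inter> path_image y1 \<subseteq> {b}" using yy by blast
  have d: "arc d" "pathstart d = f \<beta>2" "pathfinish d = f (\<beta>1 + 2 * pi)"
     "path_image d - {f \<beta>2, f (\<beta>1 + 2 * pi)} \<subseteq> inside ?S"
    "path_image d = path_image y1 \<union> path_image y2"
    using chord[OF y2(1) y1(1) y2(2) y1(2) yy'] y1 y2 unfolding f_per by (auto simp: d_def f_def)
  have r: "f \<beta>2 \<in> path_image c1 - {p, q}"
    using c1(4) lt f_inj[of \<beta>2 \<alpha>1] f_inj[of \<beta>2 \<alpha>2] by (auto simp: p_def q_def)
  have s: "f (\<beta>1 + 2 * pi) \<in> path_image c2 - {p, q}"
    using c2(4) lt f_inj[of "\<beta>1" \<alpha>1] f_inj[of "\<beta>1 + 2 * pi" \<alpha>2] unfolding f_per[of \<beta>1]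
    by (auto simp: p_def q_def intro!: image_eqI[of _ _ "\<beta>1 + 2 * pi"] f_per[symmetric])
  from crossing_chords_meet[OF c1(1-3) c2(1-3) c1c2 c(1-4) d(1-4) r s] show ?thesis
    by (simp add: c(5) d(5))
qed

end

section \<open>Branches along a ray\<close>

text \<open>Open cone with apex \<open>t\<close> about the ray in direction \<open>\<kappa>\<close>.
  It replaces the ray because branches need an open domain; it is convex, and its apex, possibly a
  critical value, is left out.\<close>

definition sector :: "complex \<Rightarrow> complex \<Rightarrow> real \<Rightarrow> complex set" where
  "sector t \<kappa> \<delta> = {z. \<bar>Im ((z - t) / \<kappa>)\<bar> < \<delta> * Re ((z - t) / \<kappa>)}"

lemma convex_affine_vimage:
  fixes C :: "complex set"
  assumes "convex C"
  shows "convex {z. (z - t) / \<kappa> \<in> C}"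
proof (rule convexI)
  fix x y :: complex and u v :: real
  assume *: "x \<in> {z. (z - t) / \<kappa> \<in> C}" "y \<in> {z. (z - t) / \<kappa> \<in> C}" "0 \<le> u" "0 \<le> v" "u + v = 1"
  then have v: "v = 1 - u" by simp
  have "(u *\<^sub>R x + v *\<^sub>R y - t) / \<kappa> = u *\<^sub>R ((x - t) / \<kappa>) + v *\<^sub>R ((y - t) / \<kappa>)"
    unfolding v by (simp add: scaleR_conv_of_real diff_divide_distrib add_divide_distrib algebra_simps)
  then show "u *\<^sub>R x + v *\<^sub>R y \<in> {z. (z - t) / \<kappa> \<in> C}"
    using convexD[OF assms, of "(x - t) / \<kappa>" "(y - t) / \<kappa>" u v] * by simp
qed

lemma convex_sector: "convex (sector t \<kappa> \<delta>)"
  and convex_sector_far: "convex (sector t \<kappa> \<delta> \<inter> {z. M < Re ((z - t) / \<kappa>)})"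
proof -
  have "{w. \<bar>Im w\<bar> < \<delta> * Re w} = {w. inner (Complex (- \<delta>) 1) w < 0} \<inter> {w. inner (Complex (- \<delta>) (-1)) w < 0}"
    by (auto simp: inner_complex_def abs_less_iff)
  then have C: "convex {w. \<bar>Im w\<bar> < \<delta> * Re w}"
    by (metis convex_Int convex_halfspace_lt)
  show 1: "convex (sector t \<kappa> \<delta>)" using convex_affine_vimage[OF C] by (simp add: sector_def)
  show "convex (sector t \<kappa> \<delta> \<inter> {z. M < Re ((z - t) / \<kappa>)})"
    using convex_Int[OF 1 convex_affine_vimage[OF convex_halfspace_Re_gt[of M]]] by simp
qed

lemma open_sector: "open (sector t \<kappa> \<delta>)"
  and open_sector_far: "open (sector t \<kappa> \<delta> \<inter> {z. M < Re ((z - t) / \<kappa>)})"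
proof -
  have c: "continuous_on UNIV (\<lambda>z. Re ((z - t) / \<kappa>))" "continuous_on UNIV (\<lambda>z. Im ((z - t) / \<kappa>))"
    unfolding divide_inverse by (intro continuous_intros)+
  then show "open (sector t \<kappa> \<delta>)" unfolding sector_def
    by (intro open_Collect_less c continuous_on_rabs continuous_on_mult continuous_on_const)
  then show "open (sector t \<kappa> \<delta> \<inter> {z. M < Re ((z - t) / \<kappa>)})"
    by (intro open_Int open_Collect_less c continuous_on_const)
qed

locale ray = infinity_param +
  fixes t \<kappa> :: complex and \<delta> :: real
  assumes kappa: "cmod \<kappa> = 1" and delta: "\<delta> > 0"
    and sector_regular: "sector t \<kappa> \<delta> \<inter> critical_values P = {}"
begin

lemma kappa_nz: "\<kappa> \<noteq> 0" using kappa by auto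

lemma ray_in_sector: "s > 0 \<Longrightarrow> t + of_real s * \<kappa> \<in> sector t \<kappa> \<delta>"
  using kappa_nz delta by (simp add: sector_def)

end

text \<open>A piece of length one of the ray is enough, since only its germ at \<open>t\<close>
  decides which branches are attached.\<close>

sublocale ray \<subseteq> R: ended_domain P "sector t \<kappa> \<delta>" "linepath (t + \<kappa>) t" t
proof
  show "simply_connected (sector t \<kappa> \<delta>)" by (simp add: convex_imp_simply_connected convex_sector)
  show "path_image (linepath (t + \<kappa>) t) - {t} \<subseteq> sector t \<kappa> \<delta>"
  proof
    fix z assume z: "z \<in> path_image (linepath (t + \<kappa>) t) - {t}"
    then obtain x where x: "0 \<le> x" "x \<le> 1" "z = (1 - x) *\<^sub>R (t + \<kappa>) + x *\<^sub>R t"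
      by (auto simp: closed_segment_def)
    then have "z = t + of_real (1 - x) * \<kappa>" by (simp add: scaleR_conv_of_real algebra_simps)
    moreover have "x \<noteq> 1" using z x by auto
    ultimately show "z \<in> sector t \<kappa> \<delta>" using ray_in_sector[of "1 - x"] x by simp
  qed
qed (use deg open_sector sector_regular kappa_nz in \<open>auto intro: arc_linepath convex_connected convex_sector\<close>)

section \<open>Expansion of the branches over the far part of a ray\<close>

context ray
begin

text \<open>The bound is measured from \<open>t\<close>; the summand \<open>cmod t\<close> converts
  it into \<open>Re (z / \<kappa>) > \<rho> ^ n\<close>, measured from 0. Hence roots of
  \<open>z\<close> have modulus above \<open>\<rho>\<close>, and \<open>z / \<kappa>\<close> avoids
  the cut of \<open>Ln\<close>.\<close>

definition far :: "complex set" where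
  "far = sector t \<kappa> \<delta> \<inter> {z. cmod t + \<rho> ^ degree P < Re ((z - t) / \<kappa>)}"

text \<open>Since \<open>t\<close> does not enter, parallel rays share the same root
  function.\<close>

definition rt :: "complex \<Rightarrow> complex" where
  "rt z = (SOME \<tau>. \<tau> ^ degree P = \<kappa>) * exp (Ln (z / \<kappa>) / of_nat (degree P))"

lemma far_Re: assumes "z \<in> far" shows "\<rho> ^ degree P < Re (z / \<kappa>)"
proof -
  have "z / \<kappa> = (z - t) / \<kappa> + t / \<kappa>" by (simp add: diff_divide_distrib)
  then have "Re (z / \<kappa>) = Re ((z - t) / \<kappa>) + Re (t / \<kappa>)" by simp
  moreover have "- cmod t \<le> Re (t / \<kappa>)"
    using abs_Re_le_cmod[of "t / \<kappa>"] kappa by (simp add: norm_divide abs_le_iff)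
  ultimately show ?thesis using assms by (simp add: far_def)
qed

lemma far_Re_pos: assumes "z \<in> far" shows "0 < Re (z / \<kappa>)"
  using far_Re[OF assms] zero_less_power[OF rho, of "degree P"] by linarith

lemma rt_power: assumes "z \<in> far" shows "rt z ^ degree P = z"
proof -
  have "\<exists>\<tau>. \<tau> ^ degree P = \<kappa>" using exists_complex_root[of "degree P" \<kappa>] deg by (metis not_less_zero)
  then have \<tau>: "(SOME \<tau>. \<tau> ^ degree P = \<kappa>) ^ degree P = \<kappa>" by (rule someI_ex)
  have "z / \<kappa> \<noteq> 0" using far_Re_pos[OF assms] by auto
  then have "exp (Ln (z / \<kappa>) / of_nat (degree P)) ^ degree P = z / \<kappa>"
    using deg by (simp add: exp_of_nat_mult[symmetric])
  then show ?thesis unfolding rt_def power_mult_distrib \<tau> using kappa_nz by simp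
qed

lemma rt_large: assumes "z \<in> far" shows "\<rho> < cmod (rt z)"
proof -
  have "\<rho> ^ degree P < cmod (z / \<kappa>)" using far_Re[OF assms] complex_Re_le_cmod[of "z / \<kappa>"] by linarith
  also have "\<dots> = cmod (rt z) ^ degree P" using rt_power[OF assms] kappa by (simp add: norm_divide flip: norm_power)
  finally show ?thesis by (rule power_less_imp_less_base) simp
qed

lemma rt_holomorphic: "rt holomorphic_on far"
proof -
  have "z / \<kappa> \<notin> \<real>\<^sub>\<le>\<^sub>0" if "z \<in> far" for z
    using far_Re_pos[OF that] by (auto simp: complex_nonpos_Reals_iff)
  then show ?thesis unfolding rt_def using kappa_nz by (intro holomorphic_intros) auto
qed

lemma far_regular: "regular_domain P far"
  using deg open_sector_far sector_regular
  by unfold_locales (auto simp: far_def intro!: convex_connected convex_sector_far)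

lemma ray_in_far: assumes "cmod t + \<rho> ^ degree P < s" shows "t + of_real s * \<kappa> \<in> far"
proof -
  have "s > 0" using assms zero_less_power[OF rho, of "degree P"] norm_ge_zero[of t] by linarith
  then show ?thesis using assms ray_in_sector[of s] kappa_nz by (simp add: far_def)
qed

lemma unit_root: assumes "\<omega> ^ degree P = 1" shows "cmod \<omega> = 1"
  using power_eq_1_iff[OF assms] deg by simp

text \<open>The function \<open>\<Psi> (\<omega> * rt z)\<close> is itself an inverse branch on the
  connected set \<open>far\<close>, so agreement at one point suffices.\<close>

lemma label_exists:
  assumes g: "g \<in> R.branches"
  shows "\<exists>\<omega>. \<omega> ^ degree P = 1 \<and> (\<forall>z\<in>far. g z = \<Psi> (\<omega> * rt z))"
proof -
  interpret F: regular_domain P far by (rule far_regular)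
  obtain z0 where z0: "z0 \<in> far" using ray_in_far[of "cmod t + \<rho> ^ degree P + 1"] by auto
  have sub: "far \<subseteq> sector t \<kappa> \<delta>" by (auto simp: far_def)
  have gb: "inverse_branch P far g"
    using g sub by (auto simp: R.branches_def inverse_branch_def intro: holomorphic_on_subset)
  have "poly P (g z0) = rt z0 ^ degree P" using gb z0 rt_power by (simp add: inverse_branch_def)
  from preimage_form[OF rt_large[OF z0] this]
  obtain \<omega> where \<omega>: "\<omega> ^ degree P = 1" "g z0 = \<Psi> (\<omega> * rt z0)" by blast
  have large: "\<rho> < cmod (\<omega> * rt z)" if "z \<in> far" for z
    using rt_large[OF that] unit_root[OF \<omega>(1)] by (simp add: norm_mult)
  have hb: "inverse_branch P far (\<lambda>z. \<Psi> (\<omega> * rt z))"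
    unfolding inverse_branch_def
  proof
    have "(\<lambda>z. \<omega> * rt z) holomorphic_on far" by (intro holomorphic_intros rt_holomorphic)
    from holomorphic_on_compose_gen[OF this hol] show "(\<lambda>z. \<Psi> (\<omega> * rt z)) holomorphic_on far"
      using large by (simp add: o_def image_subset_iff)
    show "\<forall>z\<in>far. poly P (\<Psi> (\<omega> * rt z)) = z"
      using poly_Psi[OF large] rt_power \<omega> by (simp add: power_mult_distrib)
  qed
  have "g z = \<Psi> (\<omega> * rt z)" if "z \<in> far" for z
    using F.inverse_branch_unique[OF gb hb z0 \<omega>(2) that] .
  then show ?thesis using \<omega> by blast
qed

definition label :: "(complex \<Rightarrow> complex) \<Rightarrow> complex" where
  "label g = (SOME \<omega>. \<omega> ^ degree P = 1 \<and> (\<forall>z\<in>far. g z = \<Psi> (\<omega> * rt z)))"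

lemma label:
  assumes "g \<in> R.branches"
  shows "label g ^ degree P = 1" "z \<in> far \<Longrightarrow> g z = \<Psi> (label g * rt z)"
  using someI_ex[OF label_exists[OF assms]] unfolding label_def by blast+

lemma label_inj: "inj_on label R.branches"
proof (rule inj_onI)
  fix g h assume gh: "g \<in> R.branches" "h \<in> R.branches" "label g = label h"
  obtain z0 where z0: "z0 \<in> far" using ray_in_far[of "cmod t + \<rho> ^ degree P + 1"] by auto
  then have "g z0 = h z0" using label(2)[OF gh(1) z0] label(2)[OF gh(2) z0] gh(3) by simp
  moreover have "z0 \<in> sector t \<kappa> \<delta>" using z0 by (simp add: far_def)
  ultimately show "g = h" using bij_betw_imp_inj_on[OF R.bij_branches] gh unfolding inj_on_def by blast
qed

text \<open>The weighted sum of the expansions is one power series in \<open>1 / rt z\<close>. It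
  vanishes at points tending to 0, so all its coefficients vanish.\<close>

lemma coefficient_relation:
  assumes I: "I \<subseteq> R.branches"
    and rel: "\<And>z. z \<in> sector t \<kappa> \<delta> \<Longrightarrow> (\<Sum>g\<in>I. c g * poly Q (g z)) = 0"
    and k: "- int (degree Q) \<le> k"
  shows "u k * (\<Sum>g\<in>I. c g * label g powi (- k)) = 0"
proof -
  define N where "N = degree Q"
  have fin: "finite I" using I R.finite_branches finite_subset by blast
  have l0: "label g \<noteq> 0" if "g \<in> I" for g using label(1)[of g] that I deg by (auto simp: power_0_left)
  define A where "A m = u (int m - int N) * (\<Sum>g\<in>I. c g * label g ^ N * (1 / label g) ^ m)" for m
  have zero: "(\<lambda>m. A m * (1 / rt z) ^ m) sums 0" if z: "z \<in> far" for z
  proof -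
    have rz: "rt z \<noteq> 0" using rt_large[OF z] rho by auto
    have S: "(\<lambda>m. u (int m - int N) * (1 / (label g * rt z)) ^ m) sums (poly Q (g z) / (label g * rt z) ^ N)"
      if g: "g \<in> I" for g
    proof -
      have gb: "g \<in> R.branches" using g I by blast
      have "\<rho> < cmod (label g * rt z)"
        using rt_large[OF z] unit_root[OF label(1)[OF gb]] by (simp add: norm_mult)
      from sums_Psi[OF this] show ?thesis using label(2)[OF gb z] by (simp add: N_def)
    qed
    have "(\<lambda>m. \<Sum>g\<in>I. c g * label g ^ N * (u (int m - int N) * (1 / (label g * rt z)) ^ m)) sums
          (\<Sum>g\<in>I. c g * label g ^ N * (poly Q (g z) / (label g * rt z) ^ N))"
      by (intro sums_sum sums_mult S)
    moreover have "(\<Sum>g\<in>I. c g * label g ^ N * (poly Q (g z) / (label g * rt z) ^ N)) =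
        (\<Sum>g\<in>I. c g * poly Q (g z)) / rt z ^ N"
      unfolding sum_divide_distrib using l0 rz by (intro sum.cong refl) (simp add: power_mult_distrib)
    moreover have "(\<Sum>g\<in>I. c g * poly Q (g z)) = 0" using rel[of z] z by (simp add: far_def)
    moreover have "(\<Sum>g\<in>I. c g * label g ^ N * (u (int m - int N) * (1 / (label g * rt z)) ^ m)) = A m * (1 / rt z) ^ m" for m
      unfolding A_def sum_distrib_left sum_distrib_right
      by (intro sum.cong refl) (simp add: power_divide power_mult_distrib)
    ultimately show ?thesis by simp
  qed
  \<comment> \<open>Parameters of points on the ray that lie in \<open>far\<close> from the start
    and tend to infinity.\<close>
  define s where "s j = cmod t + \<rho> ^ degree P + 1 + real j" for j :: nat
  define z where "z j = t + of_real (s j) * \<kappa>" for j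
  have zf: "z j \<in> far" for j unfolding z_def by (rule ray_in_far) (simp add: s_def)
  define \<xi> where "\<xi> j = 1 / rt (z j)" for j
  have \<xi>0: "\<xi> j \<noteq> 0" for j using rt_large[OF zf[of j]] rho by (auto simp: \<xi>_def)
  have "\<xi> \<longlonglongrightarrow> 0"
  proof -
    have "(\<lambda>j. \<xi> j ^ degree P) \<longlonglongrightarrow> 0"
    proof (rule tendsto_norm_zero_cancel, rule Lim_null_comparison)
      show "\<forall>\<^sub>F j in sequentially. norm (cmod (\<xi> j ^ degree P)) \<le> inverse (real (Suc j))"
      proof (intro always_eventually allI)
        fix j
        have "\<xi> j ^ degree P = 1 / z j" using rt_power[OF zf[of j]] by (simp add: \<xi>_def power_divide)
        moreover have "real (Suc j) \<le> cmod (z j)"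
        proof -
          have "cmod (of_real (s j) * \<kappa>) \<le> cmod (z j) + cmod t"
            using norm_triangle_ineq4[of "z j" t] by (simp add: z_def)
          moreover have "cmod (of_real (s j) * \<kappa>) = s j"
            proof -
            have "0 \<le> s j" using zero_less_power[OF rho, of "degree P"] by (simp add: s_def)
            then show ?thesis by (simp only: norm_mult norm_of_real kappa)
          qed
          ultimately show ?thesis using zero_less_power[OF rho, of "degree P"] by (simp add: s_def)
        qed
        ultimately show "norm (cmod (\<xi> j ^ degree P)) \<le> inverse (real (Suc j))"
          by (simp add: norm_divide norm_inverse divide_inverse le_imp_inverse_le del: of_nat_Suc)
      qed
    qed (rule LIMSEQ_inverse_real_of_nat)
    then have "(\<lambda>j. root (degree P) (cmod (\<xi> j ^ degree P))) \<longlonglongrightarrow> root (degree P) (cmod 0)"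
      by (intro tendsto_intros)
    then have "(\<lambda>j. cmod (\<xi> j)) \<longlonglongrightarrow> 0" using deg by (simp add: norm_power real_root_power_cancel)
    then show ?thesis by (rule tendsto_norm_zero_cancel)
  qed
  define f where "f x = (\<Sum>m. A m * x ^ m)" for x
  have f0: "f (\<xi> j) = 0" for j using zero[OF zf[of j]] unfolding f_def \<xi>_def by (rule sums_unique[symmetric])
  define d where "d = cmod (\<xi> 0)"
  have d: "d > 0" using \<xi>0[of 0] by (simp add: d_def)
  have smf: "(\<lambda>m. A m * x ^ m) sums f x" if "cmod x < d" for x
    unfolding f_def
    by (rule summable_sums, rule powser_inside[of A "\<xi> 0"]) (use zero[OF zf[of 0]] that in \<open>auto simp: sums_iff \<xi>_def d_def\<close>)
  have hol: "f holomorphic_on ball 0 d" using smf by (intro power_series_holomorphic) auto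
  have ev: "\<forall>\<^sub>F j in sequentially. cmod (\<xi> j) < e" if "e > 0" for e
    using \<open>\<xi> \<longlonglongrightarrow> 0\<close> that by (auto simp: tendsto_iff)
  have "f 0 = 0"
  proof -
    have "isCont f 0"
      using holomorphic_on_imp_continuous_on[OF hol] d by (simp add: continuous_on_eq_continuous_at)
    then have "(\<lambda>j. f (\<xi> j)) \<longlonglongrightarrow> f 0" using \<open>\<xi> \<longlonglongrightarrow> 0\<close> by (rule isCont_tendsto_compose)
    then show ?thesis by (simp add: f0 LIMSEQ_const_iff)
  qed
  \<comment> \<open>A nonzero coefficient would make 0 an isolated zero of \<open>f\<close>, against
    the zeros \<open>\<xi> j\<close>. That argument presupposes \<open>f 0 = 0\<close>, so the
    constant coefficient is settled separately, by continuity.\<close>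
  have A0: "A m = 0" for m
  proof (cases "m = 0")
    case True
    have "(\<lambda>m. A m * 0 ^ m) sums f 0" using smf[of 0] d by simp
    then have "A 0 = f 0" using powser_sums_zero_iff by blast
    then show ?thesis using True \<open>f 0 = 0\<close> by simp
  next
    case False
    show ?thesis
    proof (rule ccontr)
      assume Am: "A m \<noteq> 0"
      have sm: "(\<lambda>n. A n * (x - 0) ^ n) sums f x" if "norm (x - 0) < d" for x using smf that by simp
      obtain e where e: "e > 0" "\<And>x. x \<in> cball 0 e - {0} \<Longrightarrow> f x \<noteq> 0"
        using powser_0_nonzero[OF d sm \<open>f 0 = 0\<close> Am] False by blast
      obtain j where "cmod (\<xi> j) < e" using eventually_happens'[OF _ ev[OF e(1)]] by auto
      then show False using e(2)[of "\<xi> j"] \<xi>0[of j] f0[of j] by simp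
    qed
  qed
  define m where "m = nat (k + int N)"
  have m: "int m - int N = k" using k by (simp add: m_def N_def)
  have "label g ^ N * (1 / label g) ^ m = label g powi (- k)" if "g \<in> I" for g
    unfolding m[symmetric] using l0[OF that]
    by (simp add: power_int_diff power_one_over field_simps)
  then have "A m = u k * (\<Sum>g\<in>I. c g * label g powi (- k))"
    unfolding A_def m mult.assoc by simp
  then show ?thesis using A0[of m] by simp
qed

end

text \<open>Only finitely many directions are parallel to an element of \<open>D\<close>; once these
  are avoided, a thin enough cone about \<open>\<kappa>\<close> misses the nonzero elements. Applied
  to differences of values, the last property keeps critical values out of the sectors, and the
  nonvanishing imaginary part keeps rays with different origins disjoint.\<close>

lemma generic_direction:
  assumes "finite D"
  obtains \<kappa> :: complex and \<delta> :: real where "cmod \<kappa> = 1" "\<delta> > 0"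
    "\<And>v. v \<in> D \<Longrightarrow> v \<noteq> 0 \<Longrightarrow> Im (v / \<kappa>) \<noteq> 0"
    "\<And>v. v \<in> D \<Longrightarrow> v \<noteq> 0 \<Longrightarrow> \<not> \<bar>Im (v / \<kappa>)\<bar> < \<delta> * Re (v / \<kappa>)"
proof -
  have "connected (sphere (0::complex) 1)" by (rule connected_sphere) (simp add: DIM_complex)
  moreover have "1 \<in> sphere (0::complex) 1" "-1 \<in> sphere (0::complex) 1" by auto
  then have "sphere (0::complex) 1 \<noteq> {}" "\<nexists>x. sphere (0::complex) 1 = {x}"
    by (auto, metis one_neq_neg_one singletonD)
  ultimately have inf: "infinite (sphere (0::complex) 1)"
    using connected_finite_iff_sing by blast
  define B where "B = (\<lambda>v. v / of_real (cmod v)) ` D \<union> (\<lambda>v. - v / of_real (cmod v)) ` D"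
  have "finite B" using assms by (simp add: B_def)
  then have "sphere 0 1 - B \<noteq> {}" using inf by (metis Diff_infinite_finite finite.emptyI)
  then obtain \<kappa> where "\<kappa> \<in> sphere 0 1 - B" by blast
  then have \<kappa>: "cmod \<kappa> = 1" "\<kappa> \<notin> B" by auto
  have k0: "\<kappa> \<noteq> 0" using \<kappa> by auto
  have im: "Im (v / \<kappa>) \<noteq> 0" if v: "v \<in> D" "v \<noteq> 0" for v
  proof
    assume "Im (v / \<kappa>) = 0"
    then have r: "v / \<kappa> = of_real (Re (v / \<kappa>))" by (simp add: complex_eq_iff)
    then have vk: "v = of_real (Re (v / \<kappa>)) * \<kappa>" using k0 by (simp add: field_simps)
    define x where "x = Re (v / \<kappa>)"
    have vx: "v = of_real x * \<kappa>" using vk by (simp add: x_def)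
    have nx: "cmod v = \<bar>x\<bar>" unfolding vx by (simp only: norm_mult norm_of_real \<kappa>(1) mult_1_right)
    have x0: "x \<noteq> 0" using vx v(2) by auto
    have "\<kappa> = v / of_real (cmod v) \<or> \<kappa> = - v / of_real (cmod v)"
    proof (cases "x > 0")
      case True
      then have "\<kappa> = v / of_real (cmod v)" using x0 by (subst nx, subst vx) simp
      then show ?thesis by blast
    next
      case False
      then have "\<kappa> = - v / of_real (cmod v)" using x0 by (subst nx, subst vx) simp
      then show ?thesis by blast
    qed
    then show False using \<kappa>(2) v(1) unfolding B_def by blast
  qed
  have ev: "\<forall>\<^sub>F \<delta> in at_right 0. \<not> \<bar>Im w\<bar> < \<delta> * Re w" if "Im w \<noteq> 0" for w :: complex
  proof (rule eventually_at_rightI[of 0 "\<bar>Im w\<bar> / (\<bar>Re w\<bar> + 1)"])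
    fix \<delta> assume \<delta>: "\<delta> \<in> {0<..<\<bar>Im w\<bar> / (\<bar>Re w\<bar> + 1)}"
    then have "\<delta> * (\<bar>Re w\<bar> + 1) < \<bar>Im w\<bar>" by (simp add: pos_less_divide_eq)
    moreover have "\<delta> * Re w \<le> \<delta> * (\<bar>Re w\<bar> + 1)" using \<delta> by (intro mult_left_mono) auto
    ultimately show "\<not> \<bar>Im w\<bar> < \<delta> * Re w" by linarith
  qed (use that in auto)
  have "\<forall>\<^sub>F \<delta> in at_right 0. \<delta> > 0 \<and> (\<forall>v\<in>D - {0}. \<not> \<bar>Im (v / \<kappa>)\<bar> < \<delta> * Re (v / \<kappa>))"
    by (intro eventually_conj eventually_at_right_less eventually_ball_finite finite_Diff assms ballI ev im) auto
  from eventually_happens'[OF trivial_limit_at_right_real this]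
  obtain \<delta> where "\<delta> > 0" "\<And>v. v \<in> D \<Longrightarrow> v \<noteq> 0 \<Longrightarrow> \<not> \<bar>Im (v / \<kappa>)\<bar> < \<delta> * Re (v / \<kappa>)" by blast
  then show ?thesis using that[OF \<kappa>(1) _ im] by blast
qed

text \<open>Rays with different origins reach the circle of radius \<open>R\<close> at different
  parameters; the lower bound on \<open>s\<close> later places the point in the far part of its
  ray.\<close>

lemma point_on_ray:
  fixes t \<kappa> :: complex
  assumes "cmod \<kappa> = 1" "cmod t < R"
  obtains s where "cmod (t + of_real s * \<kappa>) = R" "R - cmod t \<le> s"
proof -
  have norm: "cmod (of_real s * \<kappa>) = \<bar>s\<bar>" for s by (simp only: norm_mult norm_of_real assms(1) mult_1_right)
  have "\<exists>s\<ge>0. s \<le> R + cmod t \<and> cmod (t + of_real s * \<kappa>) = R"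
  proof (rule IVT')
    show "cmod (t + of_real 0 * \<kappa>) \<le> R" using assms by simp
    have "0 \<le> R + cmod t" using assms norm_ge_zero[of t] by linarith
    then show "R \<le> cmod (t + of_real (R + cmod t) * \<kappa>)"
      using norm_diff_ineq[of "of_real (R + cmod t) * \<kappa>" t] norm[of "R + cmod t"] by (simp add: add.commute)
    show "0 \<le> R + cmod t" by fact
    show "continuous_on {0..R + cmod t} (\<lambda>s. cmod (t + of_real s * \<kappa>))" by (intro continuous_intros)
  qed
  then obtain s where s: "s \<ge> 0" "cmod (t + of_real s * \<kappa>) = R" by blast
  have "R \<le> cmod t + s" using norm_triangle_ineq[of t "of_real s * \<kappa>"] norm[of s] s by simp
  then show ?thesis using that s by simp
qed

section \<open>Preimages of a ray as arcs\<close>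

context ray
begin

text \<open>The value at 0 is prescribed because the apex is outside the sector, where the
  extensional function \<open>g\<close> has only its default value.\<close>

definition leg :: "(complex \<Rightarrow> complex) \<Rightarrow> complex \<Rightarrow> real \<Rightarrow> real \<Rightarrow> complex" where
  "leg g a s x = (if x = 0 then a else g (t + of_real (x * s) * \<kappa>))"

abbreviation attached :: "complex \<Rightarrow> (complex \<Rightarrow> complex) set" where
  "attached a \<equiv> branches_attached P (sector t \<kappa> \<delta>) (linepath (t + \<kappa>) t) a"

lemma poly_leg:
  assumes "g \<in> R.branches" "poly P a = t" "s > 0" "0 \<le> x"
  shows "poly P (leg g a s x) = t + of_real (x * s) * \<kappa>"
  using assms R.poly_branch[OF assms(1) ray_in_sector[of "x * s"]] by (auto simp: leg_def)

lemma leg_ends: "pathstart (leg g a s) = a" "pathfinish (leg g a s) = g (t + of_real s * \<kappa>)"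
  by (simp_all add: leg_def pathstart_def pathfinish_def)

text \<open>\<open>P\<close> maps the leg injectively to a segment, and continuity at the start is
  the attachment of \<open>g\<close> to \<open>a\<close>.\<close>

lemma arc_leg:
  assumes a: "poly P a = t" and g: "g \<in> attached a" and s: "s > 0"
  shows "arc (leg g a s)"
  unfolding arc_def path_def
proof
  have gb: "g \<in> R.branches" and lim: "(g \<longlongrightarrow> a) (at t within path_image (linepath (t + \<kappa>) t))"
    using g by (auto simp: R.branches_attached_eq[OF a])
  show "inj_on (leg g a s) {0..1}"
  proof (rule inj_onI)
    fix x y :: real assume xy: "x \<in> {0..1}" "y \<in> {0..1}" "leg g a s x = leg g a s y"
    have "0 \<le> x" "0 \<le> y" using xy by auto
    then have "t + of_real (x * s) * \<kappa> = t + of_real (y * s) * \<kappa>"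
      using poly_leg[OF gb a s, of x] poly_leg[OF gb a s, of y] xy(3) by metis
    then have "(of_real (x * s) :: complex) = of_real (y * s)" using kappa_nz by simp
    then have "x * s = y * s" by (simp only: of_real_eq_iff)
    then show "x = y" using s by simp
  qed
  show "continuous_on {0..1} (leg g a s)"
    unfolding continuous_on_def
  proof
    fix x :: real assume x: "x \<in> {0..1}"
    show "(leg g a s \<longlongrightarrow> leg g a s x) (at x within {0..1})"
    proof (cases "x = 0")
      case False
      then have "x > 0" using x by simp
      have "continuous_on (sector t \<kappa> \<delta>) g"
        using gb by (auto simp: R.branches_def inverse_branch_def intro: holomorphic_on_imp_continuous_on)
      then have "continuous_on {0<..} (\<lambda>x. g (t + of_real (x * s) * \<kappa>))"
        by (rule continuous_on_compose2) (use s ray_in_sector in \<open>auto intro!: continuous_intros simp del: of_real_mult\<close>)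
      then have "isCont (\<lambda>x. g (t + of_real (x * s) * \<kappa>)) x"
        using \<open>x > 0\<close> by (simp add: continuous_on_eq_continuous_at)
      then have "((\<lambda>x. g (t + of_real (x * s) * \<kappa>)) \<longlongrightarrow> leg g a s x) (at x within {0..1})"
        using False unfolding isCont_def leg_def by (auto intro: tendsto_within_subset)
      then show ?thesis
      proof (rule Lim_transform_eventually)
        have "\<forall>\<^sub>F y in at x within {0..1}. y \<in> {0<..}"
          using \<open>x > 0\<close> by (intro eventually_at_in_open' [THEN filter_leD[OF at_le[OF subset_UNIV]]]) auto
        then show "\<forall>\<^sub>F y in at x within {0..1}. g (t + of_real (y * s) * \<kappa>) = leg g a s y"
          by eventually_elim (simp add: leg_def)
      qed
    next
      case True
      have "filterlim (\<lambda>x. t + of_real (x * s) * \<kappa>) (at t within path_image (linepath (t + \<kappa>) t)) (at 0 within {0..1})"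
        unfolding filterlim_at
      proof
        \<comment> \<open>Below \<open>1 / s\<close> the point lies on the segment of length one
          along which attachment is defined.\<close>
        have "\<forall>\<^sub>F x in at 0 within {0..1}. x \<in> {0<..<1 / s} "
        proof -
          have "\<forall>\<^sub>F x in at (0::real) within {0..1}. x < 1 / s"
            using s by (intro order_tendstoD(2)[OF tendsto_ident_at]) auto
          moreover have "\<forall>\<^sub>F x in at (0::real) within {0..1}. x \<in> {0..1} \<and> x \<noteq> 0"
            by (simp add: eventually_at_filter)
          ultimately show ?thesis by eventually_elim auto
        qed
        then show "\<forall>\<^sub>F x in at 0 within {0..1}. t + of_real (x * s) * \<kappa> \<in> path_image (linepath (t + \<kappa>) t) \<and> t + of_real (x * s) * \<kappa> \<noteq> t"
        proof eventually_elim
          case (elim x)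
          then have xs: "0 < x * s" "x * s < 1" using s by (auto simp: pos_less_divide_eq)
          have "t + of_real (x * s) * \<kappa> = (1 - (1 - x * s)) *\<^sub>R (t + \<kappa>) + (1 - x * s) *\<^sub>R t"
            by (simp add: scaleR_conv_of_real algebra_simps)
          moreover have "0 \<le> 1 - x * s" "1 - x * s \<le> 1" using xs by auto
          ultimately have "t + of_real (x * s) * \<kappa> \<in> closed_segment (t + \<kappa>) t"
            unfolding closed_segment_def by blast
          moreover have "x \<noteq> 0" "s \<noteq> 0" using xs by auto
          ultimately show ?case using kappa_nz by simp
        qed
        have "((\<lambda>x. t + of_real (x * s) * \<kappa>) \<longlongrightarrow> t + of_real (0 * s) * \<kappa>) (at 0 within {0..1})"
          by (intro tendsto_intros)
        then show "((\<lambda>x. t + of_real (x * s) * \<kappa>) \<longlongrightarrow> t) (at 0 within {0..1})" by simp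
      qed
      from filterlim_compose[OF lim this]
      have "((\<lambda>x. g (t + of_real (x * s) * \<kappa>)) \<longlongrightarrow> a) (at 0 within {0..1})" .
      then have "(leg g a s \<longlongrightarrow> a) (at 0 within {0..1})"
      proof (rule Lim_transform_eventually)
        show "\<forall>\<^sub>F y in at 0 within {0..1}. g (t + of_real (y * s) * \<kappa>) = leg g a s y"
          by (auto simp: eventually_at_filter leg_def)
      qed
      then show ?thesis using True by (simp add: leg_def)
    qed
  qed
qed

text \<open>The value of \<open>P\<close> at a common point forces equal parameters, and distinct
  branches differ at every point of the sector. Only parameter 0 remains.\<close>

lemma legs_meet:
  assumes g: "g \<in> R.branches" "poly P a = t" and h: "h \<in> R.branches" "poly P b = t" and "g \<noteq> h" and s: "s > 0"
    and w: "w \<in> path_image (leg g a s)" "w \<in> path_image (leg h b s)"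
  shows "w = a" "w = b"
proof -
  obtain x y where x: "0 \<le> x" "w = leg g a s x" and y: "0 \<le> y" "w = leg h b s y"
    using w by (auto simp: path_image_def)
  have "t + of_real (x * s) * \<kappa> = t + of_real (y * s) * \<kappa>"
    using poly_leg[OF g s x(1)] poly_leg[OF h s y(1)] x y by simp
  then have "(of_real (x * s) :: complex) = of_real (y * s)" using kappa_nz by simp
  then have "x * s = y * s" by (simp only: of_real_eq_iff)
  then have xy: "x = y" using s by simp
  have "x = 0"
  proof (rule ccontr)
    assume "x \<noteq> 0"
    then have "g (t + of_real (x * s) * \<kappa>) = h (t + of_real (x * s) * \<kappa>)"
      using x y xy unfolding leg_def by simp
    moreover have "t + of_real (x * s) * \<kappa> \<in> sector t \<kappa> \<delta>" using x s \<open>x \<noteq> 0\<close> by (intro ray_in_sector) simp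
    ultimately have "g = h"
      using bij_betw_imp_inj_on[OF R.bij_branches] g h unfolding inj_on_def by blast
    then show False using \<open>g \<noteq> h\<close> by blast
  qed
  then show "w = a" "w = b" using x y xy by (simp_all add: leg_def)
qed

lemma cmod_poly_leg_less:
  assumes g: "g \<in> R.branches" "poly P a = t" and s: "s > 0"
    and R: "cmod (t + of_real s * \<kappa>) = R" "cmod t < R"
    and w: "w \<in> path_image (leg g a s)" "w \<noteq> pathfinish (leg g a s)"
  shows "cmod (poly P w) < R"
proof -
  obtain x where x: "0 \<le> x" "x \<le> 1" "w = leg g a s x" using w by (auto simp: path_image_def)
  have "x < 1" using x w(2) by (cases "x = 1") (auto simp: pathfinish_def)
  have "poly P w = of_real (1 - x) * t + of_real x * (t + of_real s * \<kappa>)"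
    using poly_leg[OF g s x(1)] x by (simp add: algebra_simps)
  then have "cmod (poly P w) \<le> cmod (of_real (1 - x) * t) + cmod (of_real x * (t + of_real s * \<kappa>))"
    by (simp only: norm_triangle_ineq)
  also have "\<dots> = (1 - x) * cmod t + x * R"
    using x by (simp add: norm_mult R del: of_real_diff)
  also have "\<dots> < (1 - x) * R + x * R" using R \<open>x < 1\<close> by simp
  finally show ?thesis by (simp add: algebra_simps)
qed

lemma label_relation:
  fixes c :: "(complex \<Rightarrow> complex) \<Rightarrow> int"
  assumes I: "I \<subseteq> R.branches"
    and rel: "\<And>z. z \<in> sector t \<kappa> \<delta> \<Longrightarrow> (\<Sum>g\<in>I. of_int (c g) * poly Q (g z)) = 0"
    and k: "- int (degree Q) \<le> k" "u k \<noteq> 0" "gcd k (int (degree P)) = 1"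
  shows "(\<Sum>g\<in>I. of_int (c g) * label g) = 0"
proof (rule root_of_unity_relation[OF deg])
  show "label g ^ degree P = 1" if "g \<in> I" for g using label(1) I that by blast
  show "gcd (- k) (int (degree P)) = 1" using k(3) by simp
  show "(\<Sum>g\<in>I. of_int (c g) * label g powi (- k)) = 0"
    using coefficient_relation[OF I rel k(1)] k(2) by simp
qed

end

section \<open>The theorem\<close>

lemma mult_at_pos:
  assumes "degree P > 0"
  shows "mult_at P a > 0"
proof -
  have "P - [:poly P a:] \<noteq> 0" using poly_minus_const_neq_0[OF assms] by blast
  then show ?thesis unfolding mult_at_def by (simp add: order_gt_0_iff)
qed

lemma opposite_means_contradiction:
  assumes Ra: "ray P Q u \<Psi> \<rho> (poly P a) \<kappa> \<delta>" and Rb: "ray P Q u \<Psi> \<rho> (poly P b) \<kappa> \<delta>"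
    and ab: "a \<noteq> b"
    and means: "poly P a = poly P b \<and>
        (\<Sum>g\<in>ray.attached P (poly P a) \<kappa> \<delta> a. ray.label P \<Psi> \<rho> (poly P a) \<kappa> \<delta> g) / of_nat (mult_at P a) =
        (\<Sum>g\<in>ray.attached P (poly P b) \<kappa> \<delta> b. ray.label P \<Psi> \<rho> (poly P b) \<kappa> \<delta> g) / of_nat (mult_at P b) \<or>
      Im ((poly P b - poly P a) / \<kappa>) \<noteq> 0 \<and>
        (\<Sum>g\<in>ray.attached P (poly P a) \<kappa> \<delta> a. ray.label P \<Psi> \<rho> (poly P a) \<kappa> \<delta> g) = 0 \<and>
        (\<Sum>g\<in>ray.attached P (poly P b) \<kappa> \<delta> b. ray.label P \<Psi> \<rho> (poly P b) \<kappa> \<delta> g) = 0"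
  shows False
proof -
  interpret A: ray P Q u \<Psi> \<rho> "poly P a" \<kappa> \<delta> by (fact Ra)
  interpret B: ray P Q u \<Psi> \<rho> "poly P b" \<kappa> \<delta> by (fact Rb)
  \<comment> \<open>With the factors 2 the bound \<open>R - |P a| \<le> sa\<close> yields
    \<open>sa > |P a| + \<rho> ^ n\<close>, and likewise for \<open>b\<close>; so both end points
    lie in the far part of their rays.\<close>
  define R where "R = 2 * cmod (poly P a) + 2 * cmod (poly P b) + \<rho> ^ degree P + 1"
  have \<rho>n: "\<rho> ^ degree P > 0" using A.rho by simp
  have na: "0 \<le> cmod (poly P a)" and nb: "0 \<le> cmod (poly P b)" by auto
  have aR: "cmod (poly P a) < R" and bR: "cmod (poly P b) < R"
    unfolding R_def using \<rho>n na nb by linarith+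
  obtain sa where sa: "cmod (poly P a + of_real sa * \<kappa>) = R" "R - cmod (poly P a) \<le> sa"
    using point_on_ray[OF A.kappa aR] .
  \<comment> \<open>If the rays coincide, the parameter \<open>sa\<close> is reused, so that
    \<open>za\<close> and \<open>zb\<close> agree.\<close>
  obtain sb where sb: "cmod (poly P b + of_real sb * \<kappa>) = R" "R - cmod (poly P b) \<le> sb"
      "poly P a = poly P b \<Longrightarrow> sb = sa"
    using point_on_ray[OF A.kappa bR] sa by metis
  have sa_gt: "cmod (poly P a) + \<rho> ^ degree P < sa" and sb_gt: "cmod (poly P b) + \<rho> ^ degree P < sb"
    using sa(2) sb(2) na nb \<rho>n unfolding R_def by linarith+
  then have sa0: "sa > 0" and sb0: "sb > 0" using na nb \<rho>n by linarith+
  define za where "za = poly P a + of_real sa * \<kappa>"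
  define zb where "zb = poly P b + of_real sb * \<kappa>"
  have za: "za \<in> A.far" and zb: "zb \<in> B.far"
    unfolding za_def zb_def using A.ray_in_far[OF sa_gt] B.ray_in_far[OF sb_gt] .
  define s where "s = cmod (A.rt za)"
  have sn: "s ^ degree P = R"
    unfolding s_def norm_power[symmetric] A.rt_power[OF za] using sa(1) za_def by simp
  have "cmod (B.rt zb) ^ degree P = s ^ degree P"
    unfolding sn norm_power[symmetric] B.rt_power[OF zb] using sb(1) zb_def by simp
  then have sb_eq: "cmod (B.rt zb) = s"
    using A.deg by (metis norm_ge_zero power_eq_iff_eq_base s_def)
  have s\<rho>: "\<rho> < s" unfolding s_def by (rule A.rt_large[OF za])
  then have s0: "s > 0" using A.rho by linarith
  have gA: "g \<in> A.R.branches" if "g \<in> A.attached a" for g using that by (simp add: A.R.branches_attached_eq)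
  have gB: "h \<in> B.R.branches" if "h \<in> B.attached b" for h using that by (simp add: B.R.branches_attached_eq)
  \<comment> \<open>Rotation by the unit number \<open>A.rt za / s\<close> turns labels into
    positions on the level curve: for \<open>x\<close> in \<open>X\<close> the point
    \<open>\<Psi> (s * x)\<close> is the end of a leg from \<open>a\<close>.\<close>
  define X where "X = (\<lambda>g. A.label g * (A.rt za / s)) ` A.attached a"
  define Y where "Y = (\<lambda>h. B.label h * (B.rt zb / s)) ` B.attached b"
  have ea: "cmod (A.rt za / s) = 1" and eb: "cmod (B.rt zb / s) = 1"
    using s0 sb_eq by (simp_all add: norm_divide s_def)
  have injX: "inj_on (\<lambda>g. A.label g * (A.rt za / s)) (A.attached a)"
    using A.label_inj gA ea unfolding inj_on_def by auto
  have injY: "inj_on (\<lambda>h. B.label h * (B.rt zb / s)) (B.attached b)"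
    using B.label_inj gB eb unfolding inj_on_def by auto
  note order = mult_at_pos[OF A.deg]
  have cX: "card X = mult_at P a" unfolding X_def card_image[OF injX] by (rule A.R.card_branches_attached) simp
  have cY: "card Y = mult_at P b" unfolding Y_def card_image[OF injY] by (rule B.R.card_branches_attached) simp
  have finX: "finite X" "X \<noteq> {}" and finY: "finite Y" "Y \<noteq> {}"
    using cX cY order by (metis card.infinite less_irrefl, metis card.empty less_irrefl)+
  have uX: "cmod x = 1" if x: "x \<in> X" for x
  proof -
    obtain g where g: "g \<in> A.attached a" "x = A.label g * (A.rt za / s)"
      using x unfolding X_def by blast
    show ?thesis unfolding g(2) norm_mult ea using A.unit_root[OF A.label(1)[OF gA[OF g(1)]]] by simp
  qed
  have uY: "cmod y = 1" if y: "y \<in> Y" for y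
  proof -
    obtain g where g: "g \<in> B.attached b" "y = B.label g * (B.rt zb / s)"
      using y unfolding Y_def by blast
    show ?thesis unfolding g(2) norm_mult eb using B.unit_root[OF B.label(1)[OF gB[OF g(1)]]] by simp
  qed
  \<comment> \<open>Over one ray a common point would be a start of both legs, hence
    \<open>a = b\<close>. Otherwise its image under \<open>P\<close> would lie on two rays that are
    parallel and distinct.\<close>
  have legs: "path_image (A.leg g a sa) \<inter> path_image (B.leg h b sb) = {}"
    if g: "g \<in> A.attached a" and h: "h \<in> B.attached b" for g h
  proof (cases "poly P a = poly P b")
    case True
    have F: "at (poly P a) within path_image (linepath (poly P a + \<kappa>) (poly P a)) \<noteq> bot"
      using arc_end_nontrivial A.R.arc by blast
    have "g \<noteq> h"
      using g h tendsto_unique[OF F, of g a b] ab True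
      by (auto simp: A.R.branches_attached_eq B.R.branches_attached_eq)
    have hb: "h \<in> A.R.branches" using gB[OF h] unfolding True .
    have leg: "B.leg h b sb = A.leg h b sa" using sb(3)[OF True] unfolding True by simp
    show ?thesis
    proof (rule ccontr)
      assume "\<not> ?thesis"
      then obtain w where w: "w \<in> path_image (A.leg g a sa)" "w \<in> path_image (A.leg h b sa)"
        unfolding leg by blast
      show False
        using A.legs_meet[OF gA[OF g] refl hb True[symmetric] \<open>g \<noteq> h\<close> sa0 w] ab by blast
    qed
  next
    case False
    show ?thesis
    proof (rule ccontr)
      assume "\<not> ?thesis"
      then obtain x y where xy: "0 \<le> x" "0 \<le> y" "A.leg g a sa x = B.leg h b sb y"
        by (auto simp: path_image_def)
      have "poly P a + of_real (x * sa) * \<kappa> = poly P b + of_real (y * sb) * \<kappa>"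
        using A.poly_leg[OF gA[OF g] refl sa0 xy(1)] B.poly_leg[OF gB[OF h] refl sb0 xy(2)] xy(3) by simp
      then have "poly P b - poly P a = of_real (x * sa - y * sb) * \<kappa>" by (simp add: algebra_simps)
      then have "(poly P b - poly P a) / \<kappa> = of_real (x * sa - y * sb)" using A.kappa_nz by simp
      then have "Im ((poly P b - poly P a) / \<kappa>) = 0" by (simp only: Im_complex_of_real)
      then show False using means False by blast
    qed
  qed
  have endA: "g za = \<Psi> (s * x)" if "g \<in> A.attached a" "x = A.label g * (A.rt za / s)" for g and x :: complex
    using A.label(2)[OF gA[OF that(1)] za] that(2) s0 by simp
  have endB: "h zb = \<Psi> (s * y)" if "h \<in> B.attached b" "y = B.label h * (B.rt zb / s)" for h and y :: complex
    using B.label(2)[OF gB[OF that(1)] zb] that(2) s0 by simp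
  have disj: "X \<inter> Y = {}"
  proof (rule ccontr)
    assume "X \<inter> Y \<noteq> {}"
    then obtain g h x where gh: "g \<in> A.attached a" "h \<in> B.attached b"
        "x = A.label g * (A.rt za / s)" "x = B.label h * (B.rt zb / s)"
      unfolding X_def Y_def by blast
    have "g za = h zb" using endA[OF gh(1,3)] endB[OF gh(2,4)] by (rule trans[OF _ sym])
    then have "pathfinish (A.leg g a sa) = pathfinish (B.leg h b sb)"
      using A.leg_ends B.leg_ends by (simp add: za_def zb_def)
    then show False using legs[OF gh(1,2)] by (metis disjoint_iff pathfinish_in_path_image)
  qed
  have mX: "(\<Sum>x\<in>X. x) / of_nat (card X) = (\<Sum>g\<in>A.attached a. A.label g) / of_nat (mult_at P a) * (A.rt za / s)"
    unfolding cX unfolding X_def sum.reindex[OF injX] o_def sum_distrib_right[symmetric]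
    by (rule times_divide_eq_left[symmetric])
  have mY: "(\<Sum>y\<in>Y. y) / of_nat (card Y) = (\<Sum>h\<in>B.attached b. B.label h) / of_nat (mult_at P b) * (B.rt zb / s)"
    unfolding cY unfolding Y_def sum.reindex[OF injY] o_def sum_distrib_right[symmetric]
    by (rule times_divide_eq_left[symmetric])
  \<comment> \<open>Equality of the means survives the two rotations: they are the same if
    \<open>P a = P b\<close>, and both means are zero otherwise.\<close>
  have mean: "(\<Sum>x\<in>X. x) / of_nat (card X) = (\<Sum>y\<in>Y. y) / of_nat (card Y)"
    using means
  proof (elim disjE conjE)
    assume t: "poly P a = poly P b"
      and m: "(\<Sum>g\<in>A.attached a. A.label g) / of_nat (mult_at P a) = (\<Sum>g\<in>B.attached b. B.label g) / of_nat (mult_at P b)"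
    have "zb = za" using sb(3)[OF t] t by (simp add: za_def zb_def)
    then show ?thesis unfolding mX mY m by simp
  next
    assume "(\<Sum>g\<in>A.attached a. A.label g) = 0" "(\<Sum>g\<in>B.attached b. B.label g) = 0"
    then show ?thesis unfolding mX mY by simp
  qed
  obtain \<alpha>1 \<alpha>2 \<beta>1 \<beta>2 where ang: "cis \<alpha>1 \<in> X" "cis \<alpha>2 \<in> X" "cis \<beta>1 \<in> Y" "cis \<beta>2 \<in> Y"
    and lt: "\<beta>1 < \<alpha>1" "\<alpha>1 < \<beta>2" "\<beta>2 < \<alpha>2" "\<alpha>2 < \<beta>1 + 2 * pi"
    by (rule interlaced_of_equal_means[OF finX uX finY uY disj mean])
  obtain g1 g2 h1 h2 where
      g1: "g1 \<in> A.attached a" "cis \<alpha>1 = A.label g1 * (A.rt za / s)" and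
      g2: "g2 \<in> A.attached a" "cis \<alpha>2 = A.label g2 * (A.rt za / s)" and
      h1: "h1 \<in> B.attached b" "cis \<beta>1 = B.label h1 * (B.rt zb / s)" and
      h2: "h2 \<in> B.attached b" "cis \<beta>2 = B.label h2 * (B.rt zb / s)"
    using ang unfolding X_def Y_def by blast
  have ne: "g1 \<noteq> g2" "h1 \<noteq> h2"
    using cis_eq_imp_eq[of \<alpha>1 \<alpha>2] cis_eq_imp_eq[of \<beta>1 \<beta>2] g1(2) g2(2) h1(2) h2(2) lt by auto
  have "(path_image (A.leg g1 a sa) \<union> path_image (A.leg g2 a sa)) \<inter>
        (path_image (B.leg h1 b sb) \<union> path_image (B.leg h2 b sb)) \<noteq> {}"
  proof (rule A.no_interlaced_legs[OF s\<rho> lt])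
    show "arc (A.leg g1 a sa)" "arc (A.leg g2 a sa)" "arc (B.leg h1 b sb)" "arc (B.leg h2 b sb)"
      using A.arc_leg[OF refl _ sa0] B.arc_leg[OF refl _ sb0] g1 g2 h1 h2 by blast+
    show "pathstart (A.leg g1 a sa) = a" "pathstart (A.leg g2 a sa) = a"
         "pathstart (B.leg h1 b sb) = b" "pathstart (B.leg h2 b sb) = b"
      using A.leg_ends B.leg_ends by simp_all
    show "pathfinish (A.leg g1 a sa) = \<Psi> (s * cis \<alpha>1)" "pathfinish (A.leg g2 a sa) = \<Psi> (s * cis \<alpha>2)"
      using A.leg_ends(2) endA[OF g1] endA[OF g2] by (simp_all add: za_def)
    show "pathfinish (B.leg h1 b sb) = \<Psi> (s * cis \<beta>1)" "pathfinish (B.leg h2 b sb) = \<Psi> (s * cis \<beta>2)"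
      using B.leg_ends(2) endB[OF h1] endB[OF h2] by (simp_all add: zb_def)
    show "path_image (A.leg g1 a sa) \<inter> path_image (A.leg g2 a sa) \<subseteq> {a}"
      using A.legs_meet(1)[OF gA[OF g1(1)] refl gA[OF g2(1)] refl ne(1) sa0] by blast
    show "path_image (B.leg h1 b sb) \<inter> path_image (B.leg h2 b sb) \<subseteq> {b}"
      using B.legs_meet(1)[OF gB[OF h1(1)] refl gB[OF h2(1)] refl ne(2) sb0] by blast
    fix e w assume e: "e \<in> {A.leg g1 a sa, A.leg g2 a sa, B.leg h1 b sb, B.leg h2 b sb}"
      and w: "w \<in> path_image e" "w \<noteq> pathfinish e"
    show "cmod (poly P w) < s ^ degree P"
      unfolding sn using e w A.cmod_poly_leg_less[OF gA refl sa0 sa(1) aR] B.cmod_poly_leg_less[OF gB refl sb0 sb(1) bR]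
        g1(1) g2(1) h1(1) h2(1) by blast
  qed
  then show False using legs g1(1) g2(1) h1(1) h2(1) by blast
qed

theorem theorem4p1:
  fixes P Q :: "complex poly" and n :: nat and a b c :: complex
    and U :: "complex set" and \<gamma>a \<gamma>b :: "real \<Rightarrow> complex"
    and u :: "int \<Rightarrow> complex"
  assumes "degree P = n" and "n \<ge> 1" and "a \<noteq> b"
    and "open U" and "connected U" and "simply_connected U"
    and "U \<inter> critical_values P = {}"
    and "c \<in> U" and "c \<noteq> poly P a" and "c \<noteq> poly P b"
    and "arc \<gamma>a" and "pathstart \<gamma>a = c" and "pathfinish \<gamma>a = poly P a"
    and "path_image \<gamma>a - {poly P a} \<subseteq> U"
    and "arc \<gamma>b" and "pathstart \<gamma>b = c" and "pathfinish \<gamma>b = poly P b"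
    and "path_image \<gamma>b - {poly P b} \<subseteq> U"
    and "poly P a \<noteq> poly P b \<Longrightarrow> path_image \<gamma>a \<inter> path_image \<gamma>b = {c}"
    and "poly P a = poly P b \<Longrightarrow> path_image \<gamma>a = path_image \<gamma>b"
    and "poly P a = poly P b \<Longrightarrow>
           (\<forall>z\<in>U. 1 / of_nat (mult_at P a) * (\<Sum>g\<in>branches_attached P U \<gamma>a a. poly Q (g z)) =
                  1 / of_nat (mult_at P b) * (\<Sum>g\<in>branches_attached P U \<gamma>b b. poly Q (g z)))"
    and "poly P a \<noteq> poly P b \<Longrightarrow>
           (\<forall>z\<in>U. 1 / of_nat (mult_at P a) * (\<Sum>g\<in>branches_attached P U \<gamma>a a. poly Q (g z)) = 0 \<and>
                  1 / of_nat (mult_at P b) * (\<Sum>g\<in>branches_attached P U \<gamma>b b. poly Q (g z)) = 0)"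
    and "puiseux_coeffs_at_infinity P Q u"
  shows "\<forall>k::int. gcd k (int n) = 1 \<longrightarrow> u k = 0"
proof (intro allI impI)
  fix k :: int
  assume k: "gcd k (int n) = 1"
  note n = assms(1,2) and ab = assms(3)
  have deg: "degree P > 0" using n by simp
  show "u k = 0"
  proof (rule ccontr)
    assume uk: "u k \<noteq> 0"
    have k_ge: "- int (degree Q) \<le> k"
      using uk assms(23) unfolding puiseux_coeffs_at_infinity_def by force
    have k_gcd: "gcd k (int (degree P)) = 1" using k n by simp
    obtain \<Psi> \<rho> where param: "infinity_param P Q u \<Psi> \<rho>"
      using infinity_param_exists[OF deg assms(23)] .
    \<comment> \<open>Critical values relative to both apexes, for the sectors, and
      \<open>P b - P a\<close>, for the position of the rays to each other.\<close>
    define D where "D = (\<lambda>(x, y). x - y) ` ((critical_values P \<union> {poly P b}) \<times> {poly P a, poly P b})"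
    have "finite D" using finite_critical_values[OF deg] by (simp add: D_def)
    then obtain \<kappa> \<delta> where \<kappa>: "cmod \<kappa> = 1" and \<delta>: "\<delta> > 0"
      and im: "\<And>v. v \<in> D \<Longrightarrow> v \<noteq> 0 \<Longrightarrow> Im (v / \<kappa>) \<noteq> 0"
      and cone: "\<And>v. v \<in> D \<Longrightarrow> v \<noteq> 0 \<Longrightarrow> \<not> \<bar>Im (v / \<kappa>)\<bar> < \<delta> * Re (v / \<kappa>)"
      using generic_direction by blast
    have ray: "ray P Q u \<Psi> \<rho> t \<kappa> \<delta>" if t: "t \<in> {poly P a, poly P b}" for t
    proof -
      have "sector t \<kappa> \<delta> \<inter> critical_values P = {}"
      proof (rule ccontr)
        assume "\<not> ?thesis"
        then obtain z where z: "z \<in> critical_values P" "\<bar>Im ((z - t) / \<kappa>)\<bar> < \<delta> * Re ((z - t) / \<kappa>)"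
          unfolding sector_def by blast
        have "z - t \<in> D" unfolding D_def using z(1) t by blast
        moreover have "z - t \<noteq> 0" using z(2) by auto
        ultimately show False using cone z(2) by blast
      qed
      then show ?thesis using param \<kappa> \<delta> unfolding ray_def ray_axioms_def by blast
    qed
    interpret A: ray P Q u \<Psi> \<rho> "poly P a" \<kappa> \<delta> by (rule ray) simp
    interpret B: ray P Q u \<Psi> \<rho> "poly P b" \<kappa> \<delta> by (rule ray) simp
    have Ua: "ended_domain P U \<gamma>a (poly P a)" and Ub: "ended_domain P U \<gamma>b (poly P b)"
      using assms deg by unfold_locales auto
    have attA: "A.attached x \<subseteq> A.R.branches" if "poly P x = poly P a" for x
      using that by (auto simp: A.R.branches_attached_eq)
    have attB: "B.attached x \<subseteq> B.R.branches" if "poly P x = poly P b" for x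
      using that by (auto simp: B.R.branches_attached_eq)
    have da: "mult_at P a > 0" and db: "mult_at P b > 0"
      using mult_at_pos[OF deg] by blast+
    have "poly P a = poly P b \<and>
        (\<Sum>g\<in>A.attached a. A.label g) / of_nat (mult_at P a) =
        (\<Sum>g\<in>B.attached b. B.label g) / of_nat (mult_at P b) \<or>
      Im ((poly P b - poly P a) / \<kappa>) \<noteq> 0 \<and>
        (\<Sum>g\<in>A.attached a. A.label g) = 0 \<and> (\<Sum>g\<in>B.attached b. B.label g) = 0"
    proof (cases "poly P a = poly P b")
      case True
      define c where "c x = (if x = a then of_nat (mult_at P b) else - of_nat (mult_at P a) :: complex)" for x
      \<comment> \<open>Attachment depends on an arc only through its image and, here, both arcs
        have the same one.\<close>
      have att_b: "branches_attached P U \<gamma>b b = branches_attached P U \<gamma>a b"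
        using assms(20)[OF True] by (simp add: branches_attached_def)
      have relU: "(\<Sum>x\<in>{a, b}. c x * (\<Sum>g\<in>branches_attached P U \<gamma>a x. poly Q (g z))) = 0" if "z \<in> U" for z
        using assms(21)[OF True] that da db ab unfolding att_b by (simp add: c_def field_simps)
      have relA: "(\<Sum>x\<in>{a, b}. c x * (\<Sum>g\<in>A.attached x. poly Q (g z))) = 0"
        if "z \<in> sector (poly P a) \<kappa> \<delta>" for z
        by (rule relation_transfer[OF Ua A.R.ended_domain_axioms _ relU that]) (use True in auto)
      define I where "I = A.attached a \<union> A.attached b"
      \<comment> \<open>The relation multiplied by both multiplicities: conjugation of the roots of
        unity is available for integer weights. A weight per branch makes sense because no branch
        tends to both \<open>a\<close> and \<open>b\<close>.\<close>
      define d where "d g = (if g \<in> A.attached a then int (mult_at P b) else - int (mult_at P a))" for g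
      have I: "I \<subseteq> A.R.branches" using attA True unfolding I_def by auto
      have fin: "finite (A.attached a)" "finite (A.attached b)"
        using attA True A.R.finite_branches by (metis finite_subset)+
      have F: "at (poly P a) within path_image (linepath (poly P a + \<kappa>) (poly P a)) \<noteq> bot"
        using arc_end_nontrivial A.R.arc by blast
      have disj: "A.attached a \<inter> A.attached b = {}"
        unfolding A.R.branches_attached_eq[OF refl] A.R.branches_attached_eq[OF True[symmetric]]
        using tendsto_unique[OF F] ab by blast
      have split: "(\<Sum>g\<in>I. of_int (d g) * f g) = of_nat (mult_at P b) * (\<Sum>g\<in>A.attached a. f g)
          - of_nat (mult_at P a) * (\<Sum>g\<in>A.attached b. f g)" for f :: "_ \<Rightarrow> complex"
      proof -
        have "(\<Sum>g\<in>I. of_int (d g) * f g) =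
            (\<Sum>g\<in>A.attached a. of_int (d g) * f g) + (\<Sum>g\<in>A.attached b. of_int (d g) * f g)"
          unfolding I_def by (rule sum.union_disjoint[OF fin disj])
        also have "(\<Sum>g\<in>A.attached a. of_int (d g) * f g) = (\<Sum>g\<in>A.attached a. of_nat (mult_at P b) * f g)"
          by (intro sum.cong refl) (simp add: d_def)
        also have "(\<Sum>g\<in>A.attached b. of_int (d g) * f g) = (\<Sum>g\<in>A.attached b. - of_nat (mult_at P a) * f g)"
          using disj by (intro sum.cong refl) (auto simp: d_def)
        finally show ?thesis by (simp only: sum_distrib_left[symmetric]) simp
      qed
      have "(\<Sum>g\<in>I. of_int (d g) * A.label g) = 0"
      proof (rule A.label_relation[OF I _ k_ge uk k_gcd])
        fix z assume "z \<in> sector (poly P a) \<kappa> \<delta>"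
        from relA[OF this] show "(\<Sum>g\<in>I. of_int (d g) * poly Q (g z)) = 0"
          unfolding split using ab by (simp add: c_def)
      qed
      then have "(\<Sum>g\<in>A.attached a. A.label g) / of_nat (mult_at P a) =
          (\<Sum>g\<in>A.attached b. A.label g) / of_nat (mult_at P b)"
        unfolding split using da db by (simp add: field_simps)
      then show ?thesis using True by simp
    next
      case False
      have relU: "(\<Sum>x\<in>{a}. 1 * (\<Sum>g\<in>branches_attached P U \<gamma>a x. poly Q (g z))) = 0"
          "(\<Sum>x\<in>{b}. 1 * (\<Sum>g\<in>branches_attached P U \<gamma>b x. poly Q (g z))) = 0" if "z \<in> U" for z
        using assms(22)[OF False] that da db by auto
      have relA: "(\<Sum>x\<in>{a}. 1 * (\<Sum>g\<in>A.attached x. poly Q (g z))) = 0"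
        if "z \<in> sector (poly P a) \<kappa> \<delta>" for z
        by (rule relation_transfer[OF Ua A.R.ended_domain_axioms _ relU(1) that]) auto
      have relB: "(\<Sum>x\<in>{b}. 1 * (\<Sum>g\<in>B.attached x. poly Q (g z))) = 0"
        if "z \<in> sector (poly P b) \<kappa> \<delta>" for z
        by (rule relation_transfer[OF Ub B.R.ended_domain_axioms _ relU(2) that]) auto
      have "(\<Sum>g\<in>A.attached a. of_int 1 * A.label g) = 0"
        by (rule A.label_relation[OF attA[OF refl] _ k_ge uk k_gcd]) (use relA in auto)
      moreover have "(\<Sum>g\<in>B.attached b. of_int 1 * B.label g) = 0"
        by (rule B.label_relation[OF attB[OF refl] _ k_ge uk k_gcd]) (use relB in auto)
      moreover have "Im ((poly P b - poly P a) / \<kappa>) \<noteq> 0"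
      proof (rule im)
        show "poly P b - poly P a \<in> D" unfolding D_def by blast
      qed (use False in auto)
      ultimately show ?thesis by simp
    qed
    from opposite_means_contradiction[OF A.ray_axioms B.ray_axioms ab this] show False .
  qed
qed

end
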